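(* Let $K=f(S^1)\subset\mathbb{R}^3$ be a knot and let $x=f(s)$, $y=f(t)$ be distinct points of $K$. The integrand $|\Omega_{CR}|-\Re\,\Omega_{CR}=\frac{(1-\cos\theta_K(x,y))}{|x-y|^2}\,|dx||dy|$ of $E^{(2)}(K)$ is the maximal Lorentzian modulus of a pair of infinitesimal segments, minus $1$, i.e. $\mu_L(x,x+dx,y,y+dy)-1$; precisely, $$\lim_{h,k\to 0^+}\frac{\mu_L\big(f(s),f(s+h),f(t),f(t+k)\big)-1}{h\,k}=\frac{1-\cos\theta_K(x,y)}{|x-y|^2}.$$
   Context: A knot $K=f(S^1)$ is the image of an embedding $f:S^1\to\mathbb{R}^3$ of class $C^2$, parametrized by arc-length. Spheres include planes. Conformal angle: for distinct $x,y\in K$, let $C(x,x,y)$ be the circle (possibly a line) tangent to $K$ at $x$ through $y$, oriented by $K$ at $x$, and similarly $C(y,y,x)$; $\theta_K(x,y)\in[0,\pi]$ is the angle between $C(x,x,y)$ and $C(y,y,x)$ at $x$ (equivalently at $y$). The infinitesimal cross-ratio $\Omega_{CR}$ of $dx$ and $dy$ has absolute value $\frac{|dx||dy|}{|x-y|^2}$ and argument $\theta_K(x,y)$ up to sign. The knot energy is $E^{(2)}(K)=\iint_{K\times K\setminus\triangle}\{|\Omega_{CR}|-\Re\,\Omega_{CR}\}+4$. A zone $Z$ is a region of $\mathbb{R}^3$ or $S^3=\mathbb{R}^3\cup\{\infty\}$ diffeomorphic to $S^2\times[0,1]$ bounded by two disjoint round spheres $S_1,S_2$; its modulus is $\rho(Z)=|\log(R_1/R_2)|$,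 where $R_1,R_2$ are the radii of the images of $S_1,S_2$ under a conformal transformation making them concentric, and its Lorentzian modulus is $\lambda(Z)=|L(S_1,S_2)|=\cosh\rho(Z)$ (spheres being viewed as unit space-like vectors for the Lorentz form $L$ on $\mathbb{R}^5$). For ordered four distinct points $x_1,x_2,x_3,x_4$, a zone $Z$ is separating if $x_1,x_3$ lie in one connected component of the complement of $\mathrm{Int}\,Z$ and $x_2,x_4$ in the other. The maximal Lorentzian modulus $\mu_L(x_1,x_2,x_3,x_4)$ is the supremum of $\lambda(Z)$ over separating zones $Z$, and is $1$ if there is no separating zone. *)

theory Defs
  imports "HOL-Analysis.Analysis"
begin

(* The source circle is \<real> / l\<int>, so a knot of length l is an l-periodic map on \<real>. *)
definition arclength_knot :: "(real \<Rightarrow> real^3) \<Rightarrow> real \<Rightarrow> bool" where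
  "arclength_knot f l \<longleftrightarrow>
     l > 0 \<and> (\<forall>t. f (t + l) = f t) \<and> inj_on f {0..<l} \<and>
     (\<exists>f' f''. (\<forall>t. (f has_vector_derivative f' t) (at t)) \<and>
              (\<forall>t. (f' has_vector_derivative f'' t) (at t)) \<and>
              continuous_on UNIV f'' \<and> (\<forall>t. norm (f' t) = 1))"

definition vec_angle :: "'a::real_inner \<Rightarrow> 'a \<Rightarrow> real" where
  "vec_angle u v = arccos (u \<bullet> v / (norm u * norm v))"

(* Oriented circles and lines are given by unit-speed parametrizations. *)
definition oriented_circle :: "(real \<Rightarrow> 'a::real_inner) \<Rightarrow> bool" where
  "oriented_circle c \<longleftrightarrow>
     (\<exists>p u. norm u = 1 \<and> c = (\<lambda>\<tau>. p + \<tau> *\<^sub>R u)) \<or>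
     (\<exists>p u v r. r > 0 \<and> norm u = 1 \<and> norm v = 1 \<and> u \<bullet> v = 0 \<and>
        c = (\<lambda>\<tau>. p + (r * cos (\<tau> / r)) *\<^sub>R u + (r * sin (\<tau> / r)) *\<^sub>R v))"

(* c runs along C(x,x,y), where x = f s and y = f t, with base point x at time 0. *)
definition tangent_circle :: "(real \<Rightarrow> real^3) \<Rightarrow> real \<Rightarrow> real \<Rightarrow> (real \<Rightarrow> real^3) \<Rightarrow> bool" where
  "tangent_circle f s t c \<longleftrightarrow>
     oriented_circle c \<and> c 0 = f s \<and>
     vector_derivative c (at 0) = vector_derivative f (at s) \<and> f t \<in> range c"

(* The angle at x = f s: the first circle is at x at time 0, the second one at time \<tau>. *)
definition conformal_angle :: "(real \<Rightarrow> real^3) \<Rightarrow> real \<Rightarrow> real \<Rightarrow> real" where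
  "conformal_angle f s t =
     (THE \<theta>. \<exists>c d \<tau>. tangent_circle f s t c \<and> tangent_circle f t s d \<and> d \<tau> = f s \<and>
        \<theta> = vec_angle (vector_derivative c (at 0)) (vector_derivative d (at \<tau>)))"

(* The coefficient of |dx| |dy|; the argument, which is defined only up to sign, is taken
   nonnegative. *)
definition inf_cross_ratio :: "(real \<Rightarrow> real^3) \<Rightarrow> real \<Rightarrow> real \<Rightarrow> complex" where
  "inf_cross_ratio f s t = rcis (1 / (dist (f s) (f t))\<^sup>2) (conformal_angle f s t)"

(* \<real>^3 \<union> {\<infinity>} is modelled as the unit sphere of \<real>^4 = \<real>^3 \<times> \<real>; \<real>^3 is embedded by inverse
   stereographic projection from the north pole, which plays the role of \<infinity>. *)
definition S3 :: "((real^3) \<times> real) set" where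
  "S3 = sphere 0 1"

definition stereo :: "real^3 \<Rightarrow> (real^3) \<times> real" where
  "stereo x = ((2 / ((norm x)\<^sup>2 + 1)) *\<^sub>R x, ((norm x)\<^sup>2 - 1) / ((norm x)\<^sup>2 + 1))"

definition infty :: "(real^3) \<times> real" where
  "infty = (0, 1)"

definition round_sphere :: "((real^3) \<times> real) set \<Rightarrow> bool" where
  "round_sphere S \<longleftrightarrow>
     (\<exists>c r. r > 0 \<and> S = stereo ` sphere c r) \<or>
     (\<exists>n b. n \<noteq> 0 \<and> S = insert infty (stereo ` {x. n \<bullet> x = b}))"

definition lorentz_form :: "((real^3) \<times> real) \<times> real \<Rightarrow> ((real^3) \<times> real) \<times> real \<Rightarrow> real" where
  "lorentz_form v w = fst v \<bullet> fst w - snd v * snd w"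

(* A point \<xi> of S3 spans the light-like line of (\<xi>, 1). A unit space-like vector v stands for
   the sphere of those light-like lines that are orthogonal to v; v is unique up to sign. *)
definition sphere_vector :: "((real^3) \<times> real) \<times> real \<Rightarrow> ((real^3) \<times> real) set \<Rightarrow> bool" where
  "sphere_vector v S \<longleftrightarrow> lorentz_form v v = 1 \<and> S = {\<xi> \<in> S3. lorentz_form v (\<xi>, 1) = 0}"

(* Meant for open U only. *)
primrec C_on :: "nat \<Rightarrow> ('a::real_normed_vector \<Rightarrow> 'b::real_normed_vector) \<Rightarrow> 'a set \<Rightarrow> bool" where
  "C_on 0 f U \<longleftrightarrow> continuous_on U f"
| "C_on (Suc n) f U \<longleftrightarrow>
     (\<forall>x\<in>U. f differentiable (at x)) \<and> (\<forall>v. C_on n (\<lambda>x. frechet_derivative f (at x) v) U)"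

(* On an arbitrary subset, smooth means locally extendable to a smooth map of the ambient space. *)
definition smooth_map_on ::
  "'a::real_normed_vector set \<Rightarrow> ('a \<Rightarrow> 'b::real_normed_vector) \<Rightarrow> bool" where
  "smooth_map_on S f \<longleftrightarrow>
     (\<forall>x\<in>S. \<exists>U g. open U \<and> x \<in> U \<and> (\<forall>n. C_on n g U) \<and> (\<forall>y\<in>S \<inter> U. g y = f y))"

definition diffeomorphic ::
  "'a::real_normed_vector set \<Rightarrow> 'b::real_normed_vector set \<Rightarrow> bool" where
  "diffeomorphic S T \<longleftrightarrow>
     (\<exists>f g. homeomorphism S T f g \<and> smooth_map_on S f \<and> smooth_map_on T g)"

(* S1 and S2 are determined by Z up to order. *)
definition zone ::
  "((real^3) \<times> real) set \<Rightarrow> ((real^3) \<times> real) set \<Rightarrow> ((real^3) \<times> real) set \<Rightarrow> bool" where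
  "zone Z S1 S2 \<longleftrightarrow>
     Z \<subseteq> S3 \<and> round_sphere S1 \<and> round_sphere S2 \<and> S1 \<inter> S2 = {} \<and>
     top_of_set S3 frontier_of Z = S1 \<union> S2 \<and>
     diffeomorphic Z (sphere (0::real^3) 1 \<times> {0..1::real})"

definition has_lorentzian_modulus :: "((real^3) \<times> real) set \<Rightarrow> real \<Rightarrow> bool" where
  "has_lorentzian_modulus Z m \<longleftrightarrow>
     (\<exists>S1 S2 v1 v2. zone Z S1 S2 \<and> sphere_vector v1 S1 \<and> sphere_vector v2 S2 \<and>
        m = \<bar>lorentz_form v1 v2\<bar>)"

definition separating_zone ::
  "real^3 \<Rightarrow> real^3 \<Rightarrow> real^3 \<Rightarrow> real^3 \<Rightarrow> ((real^3) \<times> real) set \<Rightarrow> bool" where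
  "separating_zone x1 x2 x3 x4 Z \<longleftrightarrow>
     (\<exists>S1 S2. zone Z S1 S2) \<and>
     (\<exists>A\<in>components (S3 - top_of_set S3 interior_of Z).
      \<exists>B\<in>components (S3 - top_of_set S3 interior_of Z).
        A \<noteq> B \<and> {stereo x1, stereo x3} \<subseteq> A \<and> {stereo x2, stereo x4} \<subseteq> B)"

(* Meant for four distinct points; the supremum is then finite. *)
definition max_lorentzian_modulus :: "real^3 \<Rightarrow> real^3 \<Rightarrow> real^3 \<Rightarrow> real^3 \<Rightarrow> real" where
  "max_lorentzian_modulus x1 x2 x3 x4 =
     (if \<exists>Z. separating_zone x1 x2 x3 x4 Z
      then Sup {m. \<exists>Z. separating_zone x1 x2 x3 x4 Z \<and> has_lorentzian_modulus Z m}
      else 1)"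

end

theory Submission
  imports Defs
begin

text \<open>The maximal Lorentzian modulus of four points has a closed form, and the limit is an expansion of
it. Write \<open>d\<^sub>i\<^sub>j\<close> for the distance of \<open>x\<^sub>i\<close> and \<open>x\<^sub>j\<close>. For distinct points the modulus is the ratio of the two
sides of Ptolemy's inequality, \<open>(d\<^sub>1\<^sub>2 d\<^sub>3\<^sub>4 + d\<^sub>1\<^sub>4 d\<^sub>2\<^sub>3) / (d\<^sub>1\<^sub>3 d\<^sub>2\<^sub>4)\<close>.

The reason is hyperbolic. The 3-sphere is the boundary of hyperbolic 4-space, points of which are
the future unit time-like vectors, with distance \<open>d\<close> given by \<open>cosh d = - L P Q\<close>. A round sphere
bounds a hyperplane, and two disjoint spheres with modulus \<open>m\<close> bound hyperplanes at distance
\<open>arcosh m\<close>. A zone separates \<open>x\<^sub>1, x\<^sub>3\<close> from \<open>x\<^sub>2, x\<^sub>4\<close> precisely when its two hyperplanes separate the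
geodesic \<open>x\<^sub>1 x\<^sub>3\<close> from the geodesic \<open>x\<^sub>2 x\<^sub>4\<close>. So the modulus cannot exceed \<open>cosh\<close> of the distance of the
two geodesics (\<open>hyperplanes_within_distance\<close>), and the hyperplanes perpendicular to the common
perpendicular at its feet attain this bound (\<open>ptolemy_ratio_attained\<close>). In terms of light-like
representatives of the four points, the feet \<open>P\<close> and \<open>Q\<close> are explicit, and \<open>- L P Q\<close> is the Ptolemy
ratio (\<open>closest_points_of_geodesics\<close>). If the geodesics meet, the ratio is 1 and no zone separates,
which is the default value of the maximal modulus.

Two topological facts link this algebra to zones. The interior of a zone can only be the region
between its two spheres, so that the complement of the interior has the two closed caps as
components (\<open>zone_interior\<close>, \<open>components_caps\<close>). Conversely, the region between two disjoint spheres is a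
zone (\<open>zone_shell\<close>). Both use a conformal chart that makes the two spheres concentric, so that the
region becomes a Euclidean shell (\<open>sphere_chart\<close>, \<open>spherical_shell\<close>).

For the limit, put \<open>x\<^sub>1 = f s\<close>, \<open>x\<^sub>2 = f (s + h)\<close>, \<open>x\<^sub>3 = f t\<close>, \<open>x\<^sub>4 = f (t + k)\<close> and \<open>w = f t - f s\<close>. The product
\<open>d\<^sub>1\<^sub>2 d\<^sub>3\<^sub>4\<close> is \<open>h k\<close> to leading order, and \<open>d\<^sub>1\<^sub>4 d\<^sub>2\<^sub>3 - d\<^sub>1\<^sub>3 d\<^sub>2\<^sub>4\<close> is \<open>- h k cos \<theta>\<close> to leading order
(\<open>tendsto_ptolemy_ratio\<close>). The cosine of the conformal angle enters because a circle through \<open>x\<close> and \<open>y\<close>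
has mirror-symmetric tangents at these points (\<open>cos_conformal_angle\<close>).\<close>

section \<open>Closure properties of the smoothness classes\<close>

lemma C_on_cong:
  assumes "open U" "\<And>x. x \<in> U \<Longrightarrow> f x = g x" "C_on n f U"
  shows "C_on n g U"
  using assms(2,3)
proof (induction n arbitrary: f g)
  case 0
  then show ?case by (metis C_on.simps(1) continuous_on_cong)
next
  case (Suc n)
  have d: "(g has_derivative frechet_derivative f (at x)) (at x)" if "x \<in> U" for x
  proof -
    have "(f has_derivative frechet_derivative f (at x)) (at x)"
      using Suc.prems(2) that by (simp add: frechet_derivative_works)
    then show ?thesis
      using has_derivative_transform_within_open[OF _ \<open>open U\<close> that] Suc.prems(1) by blast
  qed
  have "frechet_derivative g (at x) = frechet_derivative f (at x)" if "x \<in> U" for x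
    using frechet_derivative_at[OF d[OF that]] by simp
  then have "C_on n (\<lambda>x. frechet_derivative g (at x) v) U" for v
    using Suc.IH[of "\<lambda>x. frechet_derivative f (at x) v"] Suc.prems(2) by simp
  then show ?case
    using d by (auto simp: differentiable_def)
qed

text \<open>A formula for the derivative that holds only on the open set is enough, since derivatives there
depend only on the values there.\<close>

lemma C_on_SucI:
  assumes "open U" "\<And>x. x \<in> U \<Longrightarrow> (f has_derivative f' x) (at x)"
    and "\<And>v. C_on n (\<lambda>x. f' x v) U"
  shows "C_on (Suc n) f U"
proof -
  have "C_on n (\<lambda>x. frechet_derivative f (at x) v) U" for v
    by (rule C_on_cong[OF \<open>open U\<close> _ assms(3)[of v]])
      (use frechet_derivative_at[OF assms(2)] in auto)
  then show ?thesis
    using assms(2) by (auto simp: differentiable_def)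
qed

lemma C_on_has_derivative:
  assumes "C_on (Suc n) f U" "x \<in> U"
  shows "(f has_derivative frechet_derivative f (at x)) (at x)"
  using assms by (simp add: frechet_derivative_works)

lemma C_on_lower: "C_on (Suc n) f U \<Longrightarrow> C_on n f U"
proof (induction n arbitrary: f)
  case 0
  then show ?case
    by (auto intro!: continuous_at_imp_continuous_on differentiable_imp_continuous_within)
qed auto

lemma C_on_const: "open U \<Longrightarrow> C_on n (\<lambda>x. c) U"
proof (induction n arbitrary: c)
  case (Suc n)
  then show ?case by (intro C_on_SucI[where f' = "\<lambda>x v. 0"]) auto
qed auto

lemma C_on_bounded_linear:
  assumes "bounded_linear T" "open U" shows "C_on n T U"
proof (cases n)
  case 0
  then show ?thesis using assms linear_continuous_on by auto
next
  case (Suc m)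
  have "C_on (Suc m) T U"
    by (rule C_on_SucI[where f' = "\<lambda>x. T"])
      (use assms in \<open>auto intro: C_on_const bounded_linear_imp_has_derivative\<close>)
  then show ?thesis using Suc by simp
qed

lemma C_on_add:
  assumes "open U" "C_on n f U" "C_on n g U" shows "C_on n (\<lambda>x. f x + g x) U"
  using assms(2,3)
proof (induction n arbitrary: f g)
  case 0
  then show ?case by (auto intro: continuous_intros)
next
  case (Suc n)
  show ?case
    using Suc C_on_has_derivative[OF Suc.prems(1)] C_on_has_derivative[OF Suc.prems(2)]
    by (intro C_on_SucI[OF \<open>open U\<close>,
          where f' = "\<lambda>x v. frechet_derivative f (at x) v + frechet_derivative g (at x) v"])
      (auto intro!: has_derivative_add)
qed

text \<open>The product rule expresses the derivative by bilinear terms of one order less, which closes the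
induction. Scaling, products of reals and inner products are instances.\<close>

lemma C_on_bilinear:
  assumes B: "bounded_bilinear B" and "open U" "C_on n f U" "C_on n g U"
  shows "C_on n (\<lambda>x. B (f x) (g x)) U"
  using assms(3,4)
proof (induction n arbitrary: f g)
  case 0
  then show ?case using bounded_bilinear.continuous_on[OF B] by auto
next
  case (Suc n)
  show ?case
  proof (rule C_on_SucI[OF \<open>open U\<close>, where f' = "\<lambda>x v. B (f x) (frechet_derivative g (at x) v)
          + B (frechet_derivative f (at x) v) (g x)"])
    show "((\<lambda>x. B (f x) (g x)) has_derivative (\<lambda>v. B (f x) (frechet_derivative g (at x) v)
          + B (frechet_derivative f (at x) v) (g x))) (at x)" if "x \<in> U" for x
      by (rule bounded_bilinear.FDERIV[OF B]) (use that C_on_has_derivative Suc.prems in blast)+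
    show "C_on n (\<lambda>x. B (f x) (frechet_derivative g (at x) v)
          + B (frechet_derivative f (at x) v) (g x)) U" for v
      using Suc.prems C_on_lower[OF Suc.prems(1)] C_on_lower[OF Suc.prems(2)]
      by (intro C_on_add[OF \<open>open U\<close>] Suc.IH) auto
  qed
qed

lemma C_on_linear_comp:
  assumes T: "bounded_linear T" and "open U" "C_on n f U"
  shows "C_on n (\<lambda>x. T (f x)) U"
proof -
  have "bounded_bilinear (\<lambda>x (c::real). c *\<^sub>R T x)"
    using bounded_bilinear.comp1[OF bounded_bilinear.flip[OF bounded_bilinear_scaleR] T] by simp
  from C_on_bilinear[OF this assms(2,3), where g="\<lambda>_. 1"] show ?thesis
    by (simp add: C_on_const assms(2))
qed

lemmas C_on_scaleR = C_on_bilinear[OF bounded_bilinear_scaleR]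
lemmas C_on_mult = C_on_bilinear[OF bounded_bilinear_mult]
lemmas C_on_inner = C_on_bilinear[OF bounded_bilinear_inner]

text \<open>Induction works for all exponents at once, because the derivative of a power is a multiple of a
power with another exponent. Division is the exponent \<open>-1\<close>, and the norm is the exponent \<open>1/2\<close>
applied to an inner product.\<close>

lemma C_on_powr:
  fixes h :: "'a::real_normed_vector \<Rightarrow> real"
  assumes "open U" "C_on n h U" "\<And>x. x \<in> U \<Longrightarrow> h x > 0"
  shows "C_on n (\<lambda>x. h x powr a) U"
  using assms(2)
proof (induction n arbitrary: a)
  case 0
  then show ?case using assms(3) by (force intro!: continuous_intros)
next
  case (Suc n)
  show ?case
  proof (rule C_on_SucI[OF \<open>open U\<close>,
        where f' = "\<lambda>x v. (a * h x powr (a - 1)) * frechet_derivative h (at x) v"])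
    show "((\<lambda>x. h x powr a) has_derivative
          (\<lambda>v. (a * h x powr (a - 1)) * frechet_derivative h (at x) v)) (at x)" if "x \<in> U" for x
    proof -
      have "((\<lambda>y. y powr a) has_real_derivative a * h x powr (a - 1)) (at (h x))"
        using has_real_derivative_powr assms(3)[OF that] by blast
      from DERIV_compose_FDERIV[OF this C_on_has_derivative[OF Suc.prems that]]
      show ?thesis by (simp add: mult.commute)
    qed
    show "C_on n (\<lambda>x. (a * h x powr (a - 1)) * frechet_derivative h (at x) v) U" for v
      using Suc C_on_lower[OF Suc.prems] assms(1)
      by (intro C_on_mult C_on_const) auto
  qed
qed

lemma C_on_Pair:
  assumes "open U" "C_on n f U" "C_on n g U"
  shows "C_on n (\<lambda>x. (f x, g x)) U"
proof -
  have "bounded_linear (\<lambda>a. (a, 0))" "bounded_linear (\<lambda>b. (0, b))"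
    by (auto intro!: bounded_linear_Pair bounded_linear_ident bounded_linear_zero)
  then have "C_on n (\<lambda>x. (f x, 0) + (0, g x)) U"
    using assms by (intro C_on_add C_on_linear_comp[where T = "\<lambda>a. (a, 0)"]
        C_on_linear_comp[where T = "\<lambda>b. (0, b)"]) auto
  then show ?thesis by simp
qed

lemmas C_on_intros = C_on_const C_on_add C_on_scaleR C_on_mult C_on_inner C_on_Pair

lemma smooth_map_onI:
  assumes "open U" "S \<subseteq> U" "\<And>n. C_on n g U" "\<And>y. y \<in> S \<Longrightarrow> g y = f y"
  shows "smooth_map_on S f"
  using assms unfolding smooth_map_on_def by (metis IntD1 subsetD)

lemma smooth_map_on_imp_continuous_on:
  assumes "smooth_map_on S f" shows "continuous_on S f"
  unfolding continuous_on_eq_continuous_within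
proof
  fix x assume "x \<in> S"
  then obtain U g where U: "open U" "x \<in> U" "C_on 0 g U" "\<forall>y\<in>S \<inter> U. g y = f y"
    using assms unfolding smooth_map_on_def by metis
  then have "continuous (at x) g"
    by (simp add: continuous_on_eq_continuous_at)
  then have g: "continuous (at x within S) g"
    using continuous_at_imp_continuous_at_within by blast
  obtain d where "d > 0" "ball x d \<subseteq> U" using U open_contains_ball by blast
  then show "continuous (at x within S) f"
    using continuous_transform_within[OF g \<open>d > 0\<close> \<open>x \<in> S\<close>] U(4)
    by (auto simp: subset_iff dist_commute)
qed

section \<open>The conformal angle\<close>

text \<open>The perpendicular bisector of a chord is a mirror of the circle that reverses its orientation. So
the tangent at the other end of the chord \<open>w\<close> is the reflection of the first tangent in the line
spanned by \<open>w\<close>.\<close>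

lemma oriented_circle_reflects_tangent:
  fixes c :: "real \<Rightarrow> 'a::real_inner"
  assumes "oriented_circle c" and w: "c \<tau> - c 0 = w" "w \<noteq> 0"
  shows "vector_derivative c (at \<tau>) =
    (2 * (vector_derivative c (at 0) \<bullet> w) / (norm w)\<^sup>2) *\<^sub>R w - vector_derivative c (at 0)"
  using assms(1) unfolding oriented_circle_def
proof (elim disjE exE conjE)
  fix p u assume u: "norm u = 1" and c: "c = (\<lambda>\<tau>. p + \<tau> *\<^sub>R u)"
  have "vector_derivative c (at x) = u" for x
    unfolding c by (intro vector_derivative_at) (auto intro!: derivative_eq_intros)
  moreover have "w = \<tau> *\<^sub>R u" "\<tau> \<noteq> 0" using w c by auto
  moreover have "u \<bullet> u = 1" using u by (simp add: dot_square_norm)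
  ultimately show ?thesis using u
    by (simp add: power2_eq_square field_simps scaleR_2[symmetric]) 
next
  fix p u v r assume r: "r > 0" and u: "norm u = 1" and v: "norm v = 1" and uv: "u \<bullet> v = 0" 
    and c: "c = (\<lambda>\<tau>. p + (r * cos (\<tau> / r)) *\<^sub>R u + (r * sin (\<tau> / r)) *\<^sub>R v)"
  have D: "vector_derivative c (at x) = (- sin (x / r)) *\<^sub>R u + cos (x / r) *\<^sub>R v" for x
    unfolding c using r by (intro vector_derivative_at) (auto intro!: derivative_eq_intros)
  define C S where "C = cos (\<tau> / r)" and "S = sin (\<tau> / r)"
  have CS: "S * S = 1 - C * C" using sin_cos_squared_add2[of "\<tau> / r"] unfolding C_def S_def by algebra
  have we: "w = (r * (C - 1)) *\<^sub>R u + (r * S) *\<^sub>R v"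
    using w(1) by (simp add: c C_def S_def algebra_simps)
  have uu: "u \<bullet> u = 1" "v \<bullet> v = 1" using u v by (auto simp: dot_square_norm)
  have n: "(norm w)\<^sup>2 = 2 * r\<^sup>2 * (1 - C)"
  proof -
    have "(norm w)\<^sup>2 = (r * (C - 1))\<^sup>2 + (r * S)\<^sup>2"
      unfolding we power2_norm_eq_inner
      by (simp add: inner_simps uu uv inner_commute[of v u] power2_eq_square)
    also have "\<dots> = 2 * r\<^sup>2 * (1 - C)" using CS by (simp add: power2_eq_square) algebra
    finally show ?thesis .
  qed
  have C1: "1 - C \<noteq> 0" using n w(2) by auto
  have vw: "v \<bullet> w = r * S" unfolding we by (simp add: inner_simps uu uv inner_commute[of v u])
  have k: "2 * (v \<bullet> w) / (norm w)\<^sup>2 = S / (r * (1 - C))"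
    unfolding n vw using r C1 by (simp add: field_simps power2_eq_square)
  have "(2 * (v \<bullet> w) / (norm w)\<^sup>2) *\<^sub>R w = (S / (r * (1 - C)) * (r * (C - 1))) *\<^sub>R u
      + (S / (r * (1 - C)) * (r * S)) *\<^sub>R v"
    unfolding k by (simp add: we scaleR_add_right)
  also have "S / (r * (1 - C)) * (r * (C - 1)) = - S"
    using r C1 by (simp add: field_simps)
  also have "S / (r * (1 - C)) * (r * S) = (1 - C * C) / (1 - C)"
    using r by (simp add: CS)
  also have "\<dots> = 1 + C"
    using C1 by (simp add: field_simps)
  finally show ?thesis
    by (simp add: D C_def[symmetric] S_def[symmetric] algebra_simps)
qed

text \<open>A chord \<open>w\<close> parallel to the tangent \<open>u\<close> lies on the tangent line. Otherwise the centre lies on the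
normal in the plane of \<open>u\<close> and \<open>w\<close>. With \<open>w = a u + b e\<close> for a unit normal \<open>e\<close>, the radius has to be
\<open>(a\<^sup>2 + b\<^sup>2) / (2 b)\<close>.\<close>

lemma oriented_circle_exists:
  fixes p q u :: "'a::real_inner"
  assumes u: "norm u = 1" and pq: "p \<noteq> q"
  shows "\<exists>c. oriented_circle c \<and> c 0 = p \<and> vector_derivative c (at 0) = u \<and> q \<in> range c"
proof -
  define w where "w = q - p"
  define a where "a = w \<bullet> u"
  define z where "z = w - a *\<^sub>R u"
  have uu: "u \<bullet> u = 1" using u by (simp add: dot_square_norm)
  show ?thesis
  proof (cases "z = 0")
    case True
    then have "q = p + a *\<^sub>R u" by (simp add: z_def w_def algebra_simps)
    moreover have "vector_derivative (\<lambda>\<tau>. p + \<tau> *\<^sub>R u) (at 0) = u"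
      by (intro vector_derivative_at) (auto intro!: derivative_eq_intros)
    moreover have "oriented_circle (\<lambda>\<tau>. p + \<tau> *\<^sub>R u)"
      unfolding oriented_circle_def using u by blast
    ultimately show ?thesis
      by (intro exI[of _ "\<lambda>\<tau>. p + \<tau> *\<^sub>R u"]) auto
  next
    case False
    define e where "e = z /\<^sub>R norm z"
    have zu: "z \<bullet> u = 0" unfolding z_def a_def by (simp add: inner_diff_left uu)
    have e: "norm e = 1" "e \<bullet> u = 0" using False zu by (auto simp: e_def)
    have ze: "z = norm z *\<^sub>R e" using False by (simp add: e_def)
    define b where "b = norm z"
    have b: "b > 0" using False by (simp add: b_def)
    have we: "w = a *\<^sub>R u + b *\<^sub>R e" using ze by (simp add: z_def b_def algebra_simps)
    define r where "r = (a\<^sup>2 + b\<^sup>2) / (2 * b)"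
    have s0: "a\<^sup>2 + b\<^sup>2 > 0" using b by (simp add: add_nonneg_pos)
    then have r: "r > 0" using b by (simp add: r_def)
    define c where "c = (\<lambda>\<tau>. (p + r *\<^sub>R e) + (r * cos (\<tau> / r)) *\<^sub>R (- e) + (r * sin (\<tau> / r)) *\<^sub>R u)"
    have rb: "r * (2 * b) = a\<^sup>2 + b\<^sup>2" using b by (simp add: r_def)
    have "(1 - b / r)\<^sup>2 + (a / r)\<^sup>2 = (r * r - r * (2 * b) + (a\<^sup>2 + b\<^sup>2)) / (r * r)"
      using r by (simp add: field_simps power2_eq_square)
    then have "(1 - b / r)\<^sup>2 + (a / r)\<^sup>2 = 1" using rb r by simp
    then obtain \<phi> where \<phi>: "1 - b / r = cos \<phi>" "a / r = sin \<phi>" using sincos_total_2pi by metis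
    have "c (r * \<phi>) = p + (r - r * cos \<phi>) *\<^sub>R e + (r * sin \<phi>) *\<^sub>R u"
      unfolding c_def using r by (simp add: algebra_simps)
    also have "r - r * cos \<phi> = b" using r by (simp add: \<phi>[symmetric] field_simps)
    also have "r * sin \<phi> = a" using r by (simp add: \<phi>[symmetric])
    finally have "c (r * \<phi>) = q" using we by (simp add: w_def algebra_simps)
    moreover have "vector_derivative c (at 0) = u"
      unfolding c_def using r by (intro vector_derivative_at) (auto intro!: derivative_eq_intros)
    moreover have "oriented_circle c"
      unfolding oriented_circle_def using r e u
      by (intro disjI2 exI[of _ "p + r *\<^sub>R e"] exI[of _ "- e"] exI[of _ u] exI[of _ r]) (simp add: c_def)
    moreover have "c 0 = p" by (simp add: c_def)
    ultimately show ?thesis by blast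
  qed
qed

text \<open>The tangent at \<open>f s\<close> of the first circle is \<open>a\<close> by definition. That of the second one is the
reflection of \<open>g\<close> in the chord, whichever circle is chosen; this makes the description of the angle
definite.\<close>

lemma cos_conformal_angle:
  fixes f :: "real \<Rightarrow> real^3" and s t :: real
  defines "a \<equiv> vector_derivative f (at s)" and "g \<equiv> vector_derivative f (at t)"
    and "w \<equiv> f t - f s"
  assumes a: "norm a = 1" and g: "norm g = 1" and ne: "f s \<noteq> f t"
  shows "cos (conformal_angle f s t) = 2 * (a \<bullet> w) * (g \<bullet> w) / (norm w)\<^sup>2 - a \<bullet> g"
proof -
  define g' where "g' = (2 * (g \<bullet> w) / (norm w)\<^sup>2) *\<^sub>R w - g"
  have w: "w \<noteq> 0" using ne by (simp add: w_def)
  have d: "vector_derivative d (at \<tau>) = g'" if "tangent_circle f t s d" "d \<tau> = f s" for d \<tau>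
  proof -
    have "d \<tau> - d 0 = - w" using that by (simp add: tangent_circle_def w_def)
    from oriented_circle_reflects_tangent[OF _ this] that w show ?thesis
      by (simp add: tangent_circle_def g'_def g_def[symmetric])
  qed
  have "g' \<bullet> g' = 1"
  proof -
    have "w \<bullet> w \<noteq> 0" "g \<bullet> g = 1" using w g by (auto simp: dot_square_norm)
    then show ?thesis unfolding g'_def power2_norm_eq_inner
      by (simp add: inner_diff_left inner_diff_right inner_commute[of w g] field_simps)
  qed
  then have g': "norm g' = 1" by (simp add: norm_eq_sqrt_inner)
  have "conformal_angle f s t = arccos (a \<bullet> g')"
    unfolding conformal_angle_def
  proof (rule the_equality)
    obtain c where c: "tangent_circle f s t c"
      using oriented_circle_exists[OF a ne] unfolding tangent_circle_def a_def by blast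
    obtain d where d': "tangent_circle f t s d"
      using oriented_circle_exists[OF g ne[symmetric]] unfolding tangent_circle_def g_def by blast
    then obtain \<tau> where "d \<tau> = f s" unfolding tangent_circle_def by (metis rangeE)
    with c d' show "\<exists>c d \<tau>. tangent_circle f s t c \<and> tangent_circle f t s d \<and> d \<tau> = f s \<and>
        arccos (a \<bullet> g') = vec_angle (vector_derivative c (at 0)) (vector_derivative d (at \<tau>))"
      using d[OF d'] a g' by (intro exI[of _ c] exI[of _ d] exI[of _ \<tau>])
        (auto simp: vec_angle_def tangent_circle_def a_def)
  next
    fix \<theta> assume "\<exists>c d \<tau>. tangent_circle f s t c \<and> tangent_circle f t s d \<and> d \<tau> = f s \<and>
        \<theta> = vec_angle (vector_derivative c (at 0)) (vector_derivative d (at \<tau>))"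
    then obtain c d' \<tau> where *: "tangent_circle f s t c" "tangent_circle f t s d'" "d' \<tau> = f s"
      "\<theta> = vec_angle (vector_derivative c (at 0)) (vector_derivative d' (at \<tau>))" by blast
    have "vector_derivative c (at 0) = a" using *(1) by (simp add: tangent_circle_def a_def)
    then show "\<theta> = arccos (a \<bullet> g')"
      using a g' by (simp add: *(4) d[OF *(2,3)] vec_angle_def)
  qed
  moreover have "\<bar>a \<bullet> g'\<bar> \<le> 1"
    using Cauchy_Schwarz_ineq2[of a g'] a g' by simp
  ultimately have "cos (conformal_angle f s t) = a \<bullet> g'"
    by (simp add: cos_arccos_abs)
  then show ?thesis by (simp add: g'_def inner_diff_right)
qed

section \<open>The limit of the Ptolemy ratio\<close>

text \<open>By Ptolemy's inequality this is at least 1 in Euclidean space, and it is 1 for concyclic points whose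
pairs \<open>x1, x3\<close> and \<open>x2, x4\<close> interlace.\<close>

definition ptolemy_ratio :: "'a::metric_space \<Rightarrow> 'a \<Rightarrow> 'a \<Rightarrow> 'a \<Rightarrow> real" where
  "ptolemy_ratio x1 x2 x3 x4 =
     (dist x1 x2 * dist x3 x4 + dist x1 x4 * dist x2 x3) / (dist x1 x3 * dist x2 x4)"

text \<open>With the difference quotients \<open>U\<close> at \<open>s\<close> and \<open>V\<close> at \<open>t\<close>, all six distances are norms of exact linear
expressions in \<open>w\<close>, \<open>h U\<close> and \<open>k V\<close>. The difference of the squares of \<open>d\<^sub>1\<^sub>4 d\<^sub>2\<^sub>3\<close> and \<open>d\<^sub>1\<^sub>3 d\<^sub>2\<^sub>4\<close> is then
a polynomial that is divisible by \<open>h k\<close>, so that the limit needs only the convergence of \<open>U\<close> and \<open>V\<close>.\<close>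

lemma tendsto_ptolemy_ratio:
  fixes f :: "real \<Rightarrow> 'a::real_inner"
  assumes a: "(f has_vector_derivative a) (at s)" "norm a = 1"
    and g: "(f has_vector_derivative g) (at t)" "norm g = 1" and ne: "f s \<noteq> f t"
  defines "w \<equiv> f t - f s"
  shows "((\<lambda>(h, k). (ptolemy_ratio (f s) (f (s + h)) (f t) (f (t + k)) - 1) / (h * k))
     \<longlongrightarrow> (1 - (2 * (a \<bullet> w) * (g \<bullet> w) / (norm w)\<^sup>2 - a \<bullet> g)) / (norm w)\<^sup>2) (at_right 0 \<times>\<^sub>F at_right 0)"
    and "\<forall>\<^sub>F (h, k) in at_right 0 \<times>\<^sub>F at_right 0. distinct [f s, f (s + h), f t, f (t + k)]"
proof -
  let ?F = "at_right (0::real) \<times>\<^sub>F at_right (0::real)"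
  define U where "U h = (f (s + h) - f s) /\<^sub>R h" for h
  define V where "V k = (f (t + k) - f t) /\<^sub>R k" for k
  have lim: "((\<lambda>h. (f (x + h) - f x) /\<^sub>R h) \<longlongrightarrow> b) (at_right 0)"
    if "(f has_vector_derivative b) (at x)" for x b
  proof -
    have "((\<lambda>h. (f (x + h) - f x - h *\<^sub>R b) /\<^sub>R norm h) \<longlongrightarrow> 0) (at 0)"
      using that by (intro tendsto_norm_zero_cancel[where f = "\<lambda>h. (f (x + h) - f x - h *\<^sub>R b) /\<^sub>R norm h"])
        (simp add: has_vector_derivative_def has_derivative_at divide_inverse mult.commute)
    then have "((\<lambda>h. (f (x + h) - f x - h *\<^sub>R b) /\<^sub>R norm h) \<longlongrightarrow> 0) (at_right 0)"
      by (rule filterlim_mono) (auto simp: at_within_le_at)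
    then have "((\<lambda>h. (f (x + h) - f x - h *\<^sub>R b) /\<^sub>R norm h + b) \<longlongrightarrow> 0 + b) (at_right 0)"
      by (intro tendsto_intros)
    then have *: "((\<lambda>h. (f (x + h) - f x - h *\<^sub>R b) /\<^sub>R norm h + b) \<longlongrightarrow> b) (at_right 0)"
      by simp
    have "\<forall>\<^sub>F h in at_right 0. (f (x + h) - f x - h *\<^sub>R b) /\<^sub>R norm h + b = (f (x + h) - f x) /\<^sub>R h"
      using eventually_at_right_less[of "0::real"]
      by eventually_elim (simp add: scaleR_diff_right)
    from Lim_transform_eventually[OF * this] show ?thesis .
  qed
  have Ul: "((\<lambda>x. U (fst x)) \<longlongrightarrow> a) ?F" and Vl: "((\<lambda>x. V (snd x)) \<longlongrightarrow> g) ?F"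
    unfolding U_def V_def using filterlim_compose[OF lim[OF a(1)] filterlim_fst]
      filterlim_compose[OF lim[OF g(1)] filterlim_snd] by auto
  have h: "(fst \<longlongrightarrow> 0) ?F" and k: "(snd \<longlongrightarrow> 0) ?F"
    using filterlim_compose[OF _ filterlim_fst, of "\<lambda>x. x" "nhds 0" "at_right 0" "at_right 0"]
      filterlim_compose[OF _ filterlim_snd, of "\<lambda>x. x" "nhds 0" "at_right 0" "at_right 0"]
    by (auto simp: tendsto_ident_at)
  have pos: "\<forall>\<^sub>F x in ?F. fst x > 0 \<and> snd x > 0"
    by (simp add: eventually_conj eventually_compose_filterlim[OF _ filterlim_fst]
        eventually_compose_filterlim[OF _ filterlim_snd] eventually_at_right_less)
  define d13 where "d13 x = w" for x :: "real \<times> real"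
  define d14 where "d14 x = w + snd x *\<^sub>R V (snd x)" for x :: "real \<times> real"
  define d23 where "d23 x = w - fst x *\<^sub>R U (fst x)" for x :: "real \<times> real"
  define d24 where "d24 x = w + snd x *\<^sub>R V (snd x) - fst x *\<^sub>R U (fst x)" for x :: "real \<times> real"
  have l14: "(d14 \<longlongrightarrow> w) ?F" unfolding d14_def using tendsto_add[OF tendsto_const tendsto_scaleR[OF k Vl], of w] by simp
  have l23: "(d23 \<longlongrightarrow> w) ?F" unfolding d23_def using tendsto_diff[OF tendsto_const tendsto_scaleR[OF h Ul], of w] by simp
  have l24: "(d24 \<longlongrightarrow> w) ?F" using tendsto_diff[OF l14 tendsto_scaleR[OF h Ul]]
    unfolding d14_def d24_def by simp
  have w: "w \<noteq> 0" using ne by (simp add: w_def)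
  have exp: "f (s + fst x) = f s + fst x *\<^sub>R U (fst x)" "f (t + snd x) = f t + snd x *\<^sub>R V (snd x)"
    if "fst x > 0" "snd x > 0" for x
    using that by (auto simp: U_def V_def)
  have ds: "dist (f s) (f t) = norm w" "dist (f s) (f (t + snd x)) = norm (d14 x)"
    "dist (f (s + fst x)) (f t) = norm (d23 x)" "dist (f (s + fst x)) (f (t + snd x)) = norm (d24 x)"
    "dist (f s) (f (s + fst x)) = fst x * norm (U (fst x))"
    "dist (f t) (f (t + snd x)) = snd x * norm (V (snd x))"
    if "fst x > 0" "snd x > 0" for x
    unfolding exp[OF that] d14_def d23_def d24_def w_def using that
    by (auto simp: dist_norm norm_minus_commute[of "f s"] norm_minus_commute[of "f s + _"] algebra_simps)
  have nz: "\<forall>\<^sub>F x in ?F. d14 x \<noteq> 0 \<and> d23 x \<noteq> 0 \<and> d24 x \<noteq> 0 \<and> U (fst x) \<noteq> 0 \<and> V (snd x) \<noteq> 0"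
    using a(2) g(2) by (intro eventually_conj tendsto_imp_eventually_ne[OF l14 w] tendsto_imp_eventually_ne[OF l23 w]
        tendsto_imp_eventually_ne[OF l24 w] tendsto_imp_eventually_ne[OF Ul] tendsto_imp_eventually_ne[OF Vl]) auto
  have "\<forall>\<^sub>F x in ?F. distinct [f s, f (s + fst x), f t, f (t + snd x)]"
    using pos nz
  proof eventually_elim
    case (elim x)
    then have "dist (f s) (f t) > 0" "dist (f s) (f (t + snd x)) > 0"
    "dist (f (s + fst x)) (f t) > 0" "dist (f (s + fst x)) (f (t + snd x)) > 0"
    "dist (f s) (f (s + fst x)) > 0" "dist (f t) (f (t + snd x)) > 0"
      using w by (auto simp only: ds zero_less_norm_iff zero_less_mult_iff)
    then show ?case by auto
  qed
  then show "\<forall>\<^sub>F (h, k) in ?F. distinct [f s, f (s + h), f t, f (t + k)]"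
    by (simp add: case_prod_unfold)
  define N where "N x = - 4 * (w \<bullet> V (snd x)) * (w \<bullet> U (fst x))
      + 2 * fst x * (w \<bullet> V (snd x)) * (U (fst x) \<bullet> U (fst x))
      - 2 * snd x * (V (snd x) \<bullet> V (snd x)) * (w \<bullet> U (fst x))
      + fst x * snd x * (U (fst x) \<bullet> U (fst x)) * (V (snd x) \<bullet> V (snd x))
      + 2 * (w \<bullet> w) * (U (fst x) \<bullet> V (snd x))" for x
  define q where "q x = norm (d14 x) * norm (d23 x)" for x
  define r where "r x = norm w * norm (d24 x)" for x
  have poly: "(W + 2 * k * A + k * k * B) * (W - 2 * h * C + h * h * D)
      - W * (W + 2 * k * A + k * k * B - 2 * h * C + h * h * D - 2 * h * k * E)
      = h * k * (- 4 * A * C + 2 * h * A * D - 2 * k * B * C + h * k * D * B + 2 * W * E)"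
    for W A B C D E h k :: real
    by (simp add: algebra_simps)
  have Nq: "(q x)\<^sup>2 - (r x)\<^sup>2 = fst x * snd x * N x" for x
  proof -
    have "(norm (d14 x))\<^sup>2 = w \<bullet> w + 2 * snd x * (w \<bullet> V (snd x)) + snd x * snd x * (V (snd x) \<bullet> V (snd x))"
      unfolding power2_norm_eq_inner d14_def
      by (simp add: inner_add_left inner_add_right inner_commute algebra_simps)
    moreover have "(norm (d23 x))\<^sup>2 = w \<bullet> w - 2 * fst x * (w \<bullet> U (fst x)) + fst x * fst x * (U (fst x) \<bullet> U (fst x))"
      unfolding power2_norm_eq_inner d23_def
      by (simp add: inner_diff_left inner_diff_right inner_commute algebra_simps)
    moreover have "(norm (d24 x))\<^sup>2 = w \<bullet> w + 2 * snd x * (w \<bullet> V (snd x)) + snd x * snd x * (V (snd x) \<bullet> V (snd x))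
       - 2 * fst x * (w \<bullet> U (fst x)) + fst x * fst x * (U (fst x) \<bullet> U (fst x))
       - 2 * fst x * snd x * (U (fst x) \<bullet> V (snd x))"
      unfolding power2_norm_eq_inner d24_def
      by (simp add: inner_add_left inner_add_right inner_diff_left inner_diff_right
          inner_commute algebra_simps)
    ultimately show ?thesis
      unfolding q_def r_def N_def power_mult_distrib power2_norm_eq_inner[of w]
      by (simp only: poly)
  qed
  have qr: "\<forall>\<^sub>F x in ?F. (norm (U (fst x)) * norm (V (snd x)) + N x / (q x + r x)) / r x =
       (ptolemy_ratio (f s) (f (s + fst x)) (f t) (f (t + snd x)) - 1) / (fst x * snd x)"
    using pos nz
  proof eventually_elim
    case (elim x)
    then have p: "fst x > 0" "snd x > 0" by auto
    have qp: "q x > 0" "r x > 0" using elim w by (auto simp: q_def r_def)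
    have "q x - r x = ((q x)\<^sup>2 - (r x)\<^sup>2) / (q x + r x)"
      using qp by (simp add: field_simps power2_eq_square)
    then have e: "q x - r x = fst x * snd x * (N x / (q x + r x))" unfolding Nq by simp
    have "ptolemy_ratio (f s) (f (s + fst x)) (f t) (f (t + snd x)) - 1
      = (fst x * norm (U (fst x)) * (snd x * norm (V (snd x))) + q x) / r x - 1"
      unfolding ptolemy_ratio_def ds[OF p] q_def r_def by simp
    also have "\<dots> = (fst x * norm (U (fst x)) * (snd x * norm (V (snd x))) + (q x - r x)) / r x"
      using qp by (simp add: field_simps)
    also have "\<dots> = fst x * snd x * ((norm (U (fst x)) * norm (V (snd x)) + N x / (q x + r x)) / r x)"
      unfolding e by (simp add: algebra_simps add_divide_distrib)
    finally show ?case using p by simp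
  qed
  have wr: "norm w * norm w + norm w * norm w \<noteq> 0" "norm w * norm w \<noteq> 0" using w by auto
  have Nl: "(N \<longlongrightarrow> - 4 * (w \<bullet> g) * (w \<bullet> a) + 2 * 0 * (w \<bullet> g) * (a \<bullet> a)
      - 2 * 0 * (g \<bullet> g) * (w \<bullet> a) + 0 * 0 * (a \<bullet> a) * (g \<bullet> g) + 2 * (w \<bullet> w) * (a \<bullet> g)) ?F"
    unfolding N_def by (intro tendsto_intros Ul Vl h k)
  have "((\<lambda>x. (norm (U (fst x)) * norm (V (snd x)) + N x / (q x + r x)) / r x) \<longlongrightarrow>
     (norm a * norm g + (- 4 * (w \<bullet> g) * (w \<bullet> a) + 2 * 0 * (w \<bullet> g) * (a \<bullet> a)
      - 2 * 0 * (g \<bullet> g) * (w \<bullet> a) + 0 * 0 * (a \<bullet> a) * (g \<bullet> g) + 2 * (w \<bullet> w) * (a \<bullet> g))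
       / (norm w * norm w + norm w * norm w)) / (norm w * norm w)) ?F"
    unfolding q_def r_def
    by (intro tendsto_intros Ul Vl Nl l14 l23 l24 wr)
  also have "(norm a * norm g + (- 4 * (w \<bullet> g) * (w \<bullet> a) + 2 * 0 * (w \<bullet> g) * (a \<bullet> a)
      - 2 * 0 * (g \<bullet> g) * (w \<bullet> a) + 0 * 0 * (a \<bullet> a) * (g \<bullet> g) + 2 * (w \<bullet> w) * (a \<bullet> g))
       / (norm w * norm w + norm w * norm w)) / (norm w * norm w)
      = (1 - (2 * (a \<bullet> w) * (g \<bullet> w) / (norm w)\<^sup>2 - a \<bullet> g)) / (norm w)\<^sup>2"
    using w by (simp add: a(2) g(2) dot_square_norm power2_eq_square inner_commute[of w a] inner_commute[of w g] field_simps)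
  finally show "((\<lambda>(h, k). (ptolemy_ratio (f s) (f (s + h)) (f t) (f (t + k)) - 1) / (h * k))
     \<longlongrightarrow> (1 - (2 * (a \<bullet> w) * (g \<bullet> w) / (norm w)\<^sup>2 - a \<bullet> g)) / (norm w)\<^sup>2) ?F"
    unfolding case_prod_unfold by (rule Lim_transform_eventually[OF _ qr])
qed

section \<open>Lorentz geometry and the hyperbolic distance of two geodesics\<close>

type_synonym lorentz_space = "((real^3) \<times> real) \<times> real"

abbreviation L :: "lorentz_space \<Rightarrow> lorentz_space \<Rightarrow> real" where
  "L \<equiv> lorentz_form"

lemma L_commute: "L v w = L w v"
  by (simp add: lorentz_form_def inner_commute)

lemma L_simps [simp]:
  "L (u + v) w = L u w + L v w" "L w (u + v) = L w u + L w v"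
  "L (u - v) w = L u w - L v w" "L w (u - v) = L w u - L w v"
  "L (- u) w = - L u w" "L w (- u) = - L w u"
  "L (c *\<^sub>R u) w = c * L u w" "L w (c *\<^sub>R u) = c * L w u"
  "L 0 w = 0" "L w 0 = 0"
  by (simp_all add: lorentz_form_def inner_simps algebra_simps)

lemma L_eq_norm: "L v v = (norm (fst v))\<^sup>2 - (snd v)\<^sup>2"
  by (simp only: lorentz_form_def power2_norm_eq_inner power2_eq_square[of "snd v"])

lemma L_lightlike: "\<xi> \<in> S3 \<Longrightarrow> L (\<xi>, 1) (\<xi>, 1) = 0"
  by (simp add: L_eq_norm S3_def)

lemma causal_norm_le: "L v v \<le> 0 \<Longrightarrow> norm (fst v) \<le> \<bar>snd v\<bar>"
  by (simp add: L_eq_norm abs_le_square_iff[symmetric])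

text \<open>Both vectors have time parts \<open>p, q\<close> that dominate their space parts \<open>a, b\<close>, and
\<open>(p\<^sup>2 - a\<^sup>2) (q\<^sup>2 - b\<^sup>2) = (p q - a b)\<^sup>2 - (p b - q a)\<^sup>2\<close>.\<close>

lemma reverse_Cauchy_Schwarz:
  assumes "L u u \<le> 0" "L v v \<le> 0"
  shows "L u u * L v v \<le> (L u v)\<^sup>2"
proof -
  define a b p q where "a = norm (fst u)" and "b = norm (fst v)" and "p = \<bar>snd u\<bar>" and "q = \<bar>snd v\<bar>"
  have ab: "a \<le> p" "b \<le> q" "0 \<le> a" "0 \<le> b"
    using causal_norm_le assms by (auto simp: a_def b_def p_def q_def)
  have "p * q - a * b \<ge> 0" using mult_mono[OF ab(1,2)] ab by simp
  moreover have "p * q - a * b \<le> \<bar>L u v\<bar>"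
  proof -
    have "p * q - a * b \<le> \<bar>snd u * snd v\<bar> - \<bar>fst u \<bullet> fst v\<bar>"
      using Cauchy_Schwarz_ineq2[of "fst u" "fst v"] by (simp add: a_def b_def p_def q_def abs_mult)
    also have "\<dots> \<le> \<bar>L u v\<bar>" by (simp add: lorentz_form_def)
    finally show ?thesis .
  qed
  ultimately have "(p * q - a * b)\<^sup>2 \<le> (L u v)\<^sup>2"
    by (metis abs_of_nonneg abs_le_square_iff)
  moreover have "L u u * L v v = (p * q - a * b)\<^sup>2 - (p * b - q * a)\<^sup>2"
  proof -
    have "L u u = a\<^sup>2 - p\<^sup>2" "L v v = b\<^sup>2 - q\<^sup>2"
      by (simp_all add: L_eq_norm a_def b_def p_def q_def)
    then show ?thesis by (simp only:) (simp add: algebra_simps power2_eq_square)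
  qed
  moreover have "(p * b - q * a)\<^sup>2 \<ge> 0" by simp
  ultimately show ?thesis by linarith
qed

lemma timelike_snd_nonzero: "L v v < 0 \<Longrightarrow> snd v \<noteq> 0"
  by (auto simp: L_eq_norm not_less)

lemma L_future_neg:
  assumes "L u u < 0" "snd u > 0" "L v v \<le> 0" "snd v > 0"
  shows "L u v < 0"
proof -
  have "norm (fst u) < snd u"
    using assms(1,2) by (simp add: L_eq_norm power2_less_imp_less)
  moreover have "norm (fst v) \<le> snd v" using causal_norm_le[OF assms(3)] assms(4) by simp
  ultimately have "norm (fst u) * norm (fst v) < snd u * snd v"
    using assms(2,4) by (meson mult_left_mono mult_strict_right_mono norm_ge_zero order.strict_trans1)
  then show ?thesis
    using norm_cauchy_schwarz[of "fst u" "fst v"] by (simp add: lorentz_form_def)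
qed

text \<open>Time orientation is read off from the sign of the form against one future time-like vector. This is
how vectors obtained by algebra are recognised as future.\<close>

lemma future_if_L_neg:
  assumes "L u u < 0" "snd u > 0" "L v v \<le> 0" "L u v < 0"
  shows "snd v > 0"
proof (rule ccontr)
  assume "\<not> snd v > 0"
  then consider "snd v < 0" | "snd v = 0" by linarith
  then show False
  proof cases
    case 1
    then have "L u (- v) < 0" using assms L_future_neg[of u "- v"] by auto
    then show False using assms by simp
  next
    case 2
    then have "fst v = 0" using causal_norm_le[OF assms(3)] by simp
    then show False using 2 assms(4) by (simp add: lorentz_form_def)
  qed
qed

text \<open>The hyperplanes orthogonal to \<open>v1\<close> and \<open>v2\<close> have distance \<open>arcosh m\<close>, and \<open>P\<close> and \<open>Q\<close> lie on their far
sides; so the distance of \<open>P\<close> and \<open>Q\<close> is at least this. The assumption on \<open>v1 + m v2\<close> excludes the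
vectors \<open>- v1\<close> and \<open>- v2\<close>, for which the half-spaces overlap. The proof applies the reverse
Cauchy-Schwarz inequality twice: orthogonally to \<open>v2\<close>, it shows that \<open>Q\<close> is at least as far from the
first hyperplane as the second hyperplane is, and orthogonally to \<open>v1\<close>, it gives the claim.\<close>

lemma hyperplanes_within_distance:
  assumes v: "L v1 v1 = 1" "L v2 v2 = 1" "L v1 v2 = - m" and m: "m > 1"
    and fut: "snd (v1 + m *\<^sub>R v2) > 0"
    and P: "L P P = -1" "snd P > 0" "L v1 P \<ge> 0"
    and Q: "L Q Q = -1" "snd Q > 0" "L v2 Q \<ge> 0"
  shows "m \<le> - L P Q"
proof -
  define \<alpha> \<gamma> b where "\<alpha> = L v1 P" and "\<gamma> = L v1 Q" and "b = L v2 Q"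
  have ab: "\<alpha> \<ge> 0" "b \<ge> 0" using P Q by (auto simp: \<alpha>_def b_def)
  have comm: "L v2 v1 = - m" "L P v1 = \<alpha>" "L Q v1 = \<gamma>" "L Q v2 = b"
    using v L_commute by (auto simp: \<alpha>_def \<gamma>_def b_def)
  have mm: "m * m > 1" using m by (simp add: less_1_mult)
  \<comment> \<open>the part of \<open>v1\<close> orthogonal to \<open>v2\<close>; being future, it puts \<open>Q\<close> on the negative side of the first hyperplane\<close>
  define z where "z = v1 + m *\<^sub>R v2"
  have zz: "L z z = 1 - m * m" by (simp add: z_def v comm algebra_simps)
  have zQ: "L z Q = \<gamma> + m * b" by (simp add: z_def \<gamma>_def b_def)
  have "L z Q < 0" using L_future_neg[of z Q] zz mm fut Q by (simp add: z_def)
  moreover have "(m * m - 1) * (1 + b * b) \<le> (L z Q)\<^sup>2"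
  proof -
    define Y where "Y = Q - b *\<^sub>R v2"
    have Y: "L Y Y = - (1 + b * b)"
      by (simp add: Y_def Q comm v b_def[symmetric] algebra_simps)
    have "L z z \<le> 0" "L Y Y \<le> 0" using zz mm Y zero_le_square[of b] by linarith+
    then have "L z z * L Y Y \<le> (L z Y)\<^sup>2"
      by (rule reverse_Cauchy_Schwarz)
    moreover have "L z Y = L z Q"
      by (simp add: Y_def z_def v)
    moreover have "L z z * L Y Y = (m * m - 1) * (1 + b * b)"
      by (simp add: zz Y algebra_simps)
    ultimately show ?thesis by simp
  qed
  ultimately have \<gamma>: "\<gamma> \<le> 0" "1 + \<gamma> * \<gamma> \<ge> m * m"
  proof -
    assume neg: "L z Q < 0" and sq: "(m * m - 1) * (1 + b * b) \<le> (L z Q)\<^sup>2"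
    have mb: "m * b \<ge> 0" using m ab by simp
    then show "\<gamma> \<le> 0" using neg zQ by linarith
    have "m * m - 1 \<le> (m * m - 1) * (1 + b * b)"
      using mult_left_mono[of 1 "1 + b * b" "m * m - 1"] mm by simp
    moreover have "(L z Q)\<^sup>2 \<le> \<gamma>\<^sup>2"
      using neg zQ mb by (simp add: abs_le_square_iff[symmetric])
    ultimately show "1 + \<gamma> * \<gamma> \<ge> m * m" using sq by (simp add: power2_eq_square)
  qed
  define e where "e = L P Q - \<alpha> * \<gamma>"
  have prod: "(1 + \<alpha> * \<alpha>) * (1 + \<gamma> * \<gamma>) \<le> e\<^sup>2"
  proof -
    define Y Z where "Y = P - \<alpha> *\<^sub>R v1" and "Z = Q - \<gamma> *\<^sub>R v1"
    have YZ: "L Y Y = - (1 + \<alpha> * \<alpha>)" "L Z Z = - (1 + \<gamma> * \<gamma>)" "L Y Z = e"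
      by (simp_all add: Y_def Z_def P Q comm v \<alpha>_def[symmetric] \<gamma>_def[symmetric] e_def algebra_simps)
    have "L Y Y \<le> 0" "L Z Z \<le> 0"
      using YZ zero_le_square[of \<alpha>] zero_le_square[of \<gamma>] by linarith+
    then have "L Y Y * L Z Z \<le> (L Y Z)\<^sup>2"
      by (rule reverse_Cauchy_Schwarz)
    then show ?thesis unfolding YZ by (simp add: algebra_simps)
  qed
  have e2: "m * m + (\<alpha> * \<gamma>)\<^sup>2 \<le> e\<^sup>2"
  proof -
    have "(1 + \<alpha> * \<alpha>) * (1 + \<gamma> * \<gamma>) = (1 + \<gamma> * \<gamma>) + \<alpha> * \<alpha> + (\<alpha> * \<gamma>)\<^sup>2"
      by (simp add: power2_eq_square algebra_simps)
    with prod \<gamma>(2) zero_le_square[of \<alpha>] show ?thesis by linarith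
  qed
  have PQ: "L P Q < 0" using L_future_neg[of P Q] P Q by simp
  have "e \<le> 0"
  proof (rule ccontr)
    assume "\<not> e \<le> 0"
    moreover have "e \<le> - (\<alpha> * \<gamma>)" using PQ by (simp add: e_def)
    ultimately have "e\<^sup>2 \<le> (- (\<alpha> * \<gamma>))\<^sup>2" by (intro power_mono) auto
    then show False using e2 mm by simp
  qed
  moreover have "m\<^sup>2 \<le> e\<^sup>2" using e2 zero_le_power2[of "\<alpha> * \<gamma>"]
    unfolding power2_eq_square[of m] by linarith
  ultimately have "m \<le> - e" using m by (simp add: abs_le_square_iff[symmetric])
  moreover have "\<alpha> * \<gamma> \<le> 0" using ab \<gamma>(1) by (simp add: mult_nonneg_nonpos)
  ultimately show ?thesis by (simp add: e_def)
qed

text \<open>Scaling the light-like vector of a point in this way makes the Lorentz form of two points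
\<open>-1/2\<close> times their squared distance.\<close>

definition light_vector :: "real^3 \<Rightarrow> lorentz_space" where
  "light_vector x = (((norm x)\<^sup>2 + 1) / 2) *\<^sub>R (stereo x, 1)"

lemma light_vector_simps:
  "fst (fst (light_vector x)) = x"
  "snd (fst (light_vector x)) = ((norm x)\<^sup>2 - 1) / 2"
  "snd (light_vector x) = ((norm x)\<^sup>2 + 1) / 2"
proof -
  define N where "N = (norm x)\<^sup>2 + 1"
  have "N \<noteq> 0" "(norm x)\<^sup>2 - 1 = N - 2" using zero_le_power2[of "norm x"] by (simp_all add: N_def add_nonneg_eq_0_iff)
  then show "fst (fst (light_vector x)) = x"
    "snd (fst (light_vector x)) = ((norm x)\<^sup>2 - 1) / 2"
    "snd (light_vector x) = ((norm x)\<^sup>2 + 1) / 2"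
    by (simp_all add: light_vector_def stereo_def N_def[symmetric])
qed

lemma L_light_vector: "L (light_vector x) (light_vector y) = - (dist x y)\<^sup>2 / 2"
  by (simp add: lorentz_form_def inner_prod_def light_vector_simps dist_norm)
    (simp add: power2_norm_eq_inner inner_diff_left inner_diff_right inner_commute field_simps)

lemma stereo_in_S3: "stereo x \<in> S3"
proof -
  have "L (light_vector x) (light_vector x) = 0" by (simp add: L_light_vector)
  moreover have "(norm x)\<^sup>2 + 1 \<noteq> 0" using zero_le_power2[of "norm x"] by linarith
  ultimately have "L (stereo x, 1) (stereo x, 1) = 0"
    by (simp add: light_vector_def del: scaleR_Pair)
  then show ?thesis by (simp add: L_eq_norm S3_def abs_square_eq_1)
qed

text \<open>A unit time-like vector \<open>P = p1 X1 + p3 X3\<close> with positive coefficients is a point of the geodesic with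
ends \<open>x1\<close> and \<open>x3\<close>, and similarly \<open>Q\<close>. The last four equations say that \<open>Q - \<mu> P\<close> and \<open>P - \<mu> Q\<close> are
orthogonal to the first and the second geodesic, that is, that \<open>P\<close> and \<open>Q\<close> are the feet of the
common perpendicular, or the common point if the geodesics meet.
The parameters \<open>u\<close> and \<open>w\<close> give the positions of \<open>P\<close> and \<open>Q\<close> on their geodesics; minimising
\<open>(u w a\<^sup>2 + d\<^sup>2 / (u w) + (u / w) b\<^sup>2 + (w / u) c\<^sup>2) / (2 e g)\<close>, which is \<open>- L P Q\<close>, leads to \<open>u w = d / a\<close>
and \<open>u / w = c / b\<close>.\<close>

lemma closest_points_of_geodesics:
  assumes "distinct [x1, x2, x3, x4]"
  defines "\<mu> \<equiv> ptolemy_ratio x1 x2 x3 x4"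
  obtains p1 p3 q2 q4 :: real and P Q where
    "p1 > 0" "p3 > 0" "q2 > 0" "q4 > 0"
    "P = p1 *\<^sub>R light_vector x1 + p3 *\<^sub>R light_vector x3"
    "Q = q2 *\<^sub>R light_vector x2 + q4 *\<^sub>R light_vector x4"
    "L P P = -1" "snd P > 0" "L Q Q = -1" "snd Q > 0" "L P Q = - \<mu>"
    "L Q (light_vector x1) = \<mu> * L P (light_vector x1)"
    "L Q (light_vector x3) = \<mu> * L P (light_vector x3)"
    "L P (light_vector x2) = \<mu> * L Q (light_vector x2)"
    "L P (light_vector x4) = \<mu> * L Q (light_vector x4)"
proof -
  define a where "a = dist x1 x2"
  define b where "b = dist x1 x4"
  define c where "c = dist x2 x3"
  define d where "d = dist x3 x4"
  define e where "e = dist x1 x3"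
  define g where "g = dist x2 x4"
  have pos: "a > 0" "b > 0" "c > 0" "d > 0" "e > 0" "g > 0"
    using assms(1) by (auto simp: a_def b_def c_def d_def e_def g_def)
  have \<mu>: "\<mu> * (e * g) = a * d + b * c"
    using pos by (simp add: \<mu>_def ptolemy_ratio_def a_def b_def c_def d_def e_def g_def)
  define u where "u = sqrt (d * c / (a * b))"
  define w where "w = u * b / c"
  have u: "u > 0" "u * u = d * c / (a * b)" using pos by (auto simp: u_def)
  have w: "w > 0" using u pos by (simp add: w_def)
  have uw: "d = u * w * a" "c * w = u * b"
    using u pos by (auto simp: w_def field_simps)
  define P where "P = (u / e) *\<^sub>R light_vector x1 + (1 / (u * e)) *\<^sub>R light_vector x3"
  define Q where "Q = (w / g) *\<^sub>R light_vector x2 + (1 / (w * g)) *\<^sub>R light_vector x4"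
  have D: "L (light_vector x1) (light_vector x2) = - (a * a) / 2" "L (light_vector x2) (light_vector x1) = - (a * a) / 2"
    "L (light_vector x1) (light_vector x3) = - (e * e) / 2" "L (light_vector x3) (light_vector x1) = - (e * e) / 2"
    "L (light_vector x1) (light_vector x4) = - (b * b) / 2" "L (light_vector x4) (light_vector x1) = - (b * b) / 2"
    "L (light_vector x2) (light_vector x3) = - (c * c) / 2" "L (light_vector x3) (light_vector x2) = - (c * c) / 2"
    "L (light_vector x2) (light_vector x4) = - (g * g) / 2" "L (light_vector x4) (light_vector x2) = - (g * g) / 2"
    "L (light_vector x3) (light_vector x4) = - (d * d) / 2" "L (light_vector x4) (light_vector x3) = - (d * d) / 2"
    "L (light_vector x) (light_vector x) = 0" for x
    by (auto simp: L_light_vector a_def b_def c_def d_def e_def g_def dist_commute power2_eq_square)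
  have PX: "L P (light_vector x1) = - e / (2 * u)" "L P (light_vector x3) = - u * e / 2"
    "L P (light_vector x2) = - (u * u * a * a + c * c) / (2 * u * e)"
    "L P (light_vector x4) = - (u * u * b * b + d * d) / (2 * u * e)"
    using pos u by (simp_all add: P_def D field_simps)
  have QX: "L Q (light_vector x2) = - g / (2 * w)" "L Q (light_vector x4) = - w * g / 2"
    "L Q (light_vector x1) = - (w * w * a * a + b * b) / (2 * w * g)"
    "L Q (light_vector x3) = - (w * w * c * c + d * d) / (2 * w * g)"
    using pos w by (simp_all add: Q_def D field_simps)
  have I: "u * (w * w * a * a + b * b) = w * (a * d + b * c)"
    "w * w * c * c + d * d = u * w * (a * d + b * c)"
    "w * (u * u * a * a + c * c) = u * (a * d + b * c)"
    "u * u * b * b + d * d = u * w * (a * d + b * c)"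
    using uw by algebra+
  have XQ: "L Q (light_vector x1) = \<mu> * L P (light_vector x1)"
    "L Q (light_vector x3) = \<mu> * L P (light_vector x3)"
    "L P (light_vector x2) = \<mu> * L Q (light_vector x2)"
    "L P (light_vector x4) = \<mu> * L Q (light_vector x4)"
    using I pos u(1) w unfolding PX QX \<mu>[symmetric] by (simp_all add: field_simps)
  have "L P P = (u / e) * L P (light_vector x1) + (1 / (u * e)) * L P (light_vector x3)"
    by (subst (2) P_def) simp
  then have PP: "L P P = -1"
    using pos u(1) unfolding PX(1,2) by (simp add: field_simps)
  have "L Q Q = (w / g) * L Q (light_vector x2) + (1 / (w * g)) * L Q (light_vector x4)"
    by (subst (2) Q_def) simp
  then have QQ: "L Q Q = -1"
    using pos w unfolding QX(1,2) by (simp add: field_simps)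
  have "L P Q = (w / g) * L P (light_vector x2) + (1 / (w * g)) * L P (light_vector x4)"
    by (subst Q_def) simp
  also have "\<dots> = \<mu> * L Q Q" unfolding XQ(3,4)
    by (subst (4) Q_def) (simp add: algebra_simps)
  finally have PQ: "L P Q = - \<mu>" using QQ by simp
  have sn: "snd (light_vector x) > 0" for x
    using zero_le_power2[of "norm x"] by (simp add: light_vector_simps add_nonneg_pos)
  have "snd P > 0" "snd Q > 0" using sn pos u w by (auto simp: P_def Q_def intro!: add_pos_pos)
  then show thesis
    using that[of "u / e" "1 / (u * e)" "w / g" "1 / (w * g)" P Q] pos u w PP QQ PQ XQ P_def Q_def
    by simp
qed

text \<open>Ptolemy's inequality: the ratio is \<open>cosh\<close> of a hyperbolic distance.\<close>

lemma ptolemy_ratio_ge_1: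
  fixes x1 x2 x3 x4 :: "real^3"
  assumes "distinct [x1, x2, x3, x4]" shows "ptolemy_ratio x1 x2 x3 x4 \<ge> 1"
proof -
  obtain P Q where "L P P = -1" "snd P > 0" "L Q Q = -1" "snd Q > 0"
    and PQ: "L P Q = - ptolemy_ratio x1 x2 x3 x4"
    using closest_points_of_geodesics[OF assms] by metis
  then have "1 \<le> (L P Q)\<^sup>2" "L P Q < 0"
    using reverse_Cauchy_Schwarz[of P Q] L_future_neg[of P Q] by auto
  then show ?thesis
    using PQ abs_le_square_iff[of 1 "L P Q"] by simp
qed

section \<open>A conformal chart of the sphere adapted to a unit space-like vector\<close>

text \<open>An orthonormal frame of the Lorentz space, consisting of a future time-like \<open>n\<close>, the given space-like
\<open>v\<close>, and an isometric copy of Euclidean 3-space given by \<open>E\<close>. The map \<open>G\<close> takes the coordinates in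
the latter.\<close>

locale sphere_chart =
  fixes n v :: lorentz_space and E :: "real^3 \<Rightarrow> lorentz_space" and G :: "lorentz_space \<Rightarrow> real^3"
  assumes n: "L n n = -1" "snd n > 0" and v: "L v v = 1" and nv: "L n v = 0"
    and linear_E: "linear E" and linear_G: "linear G"
    and E: "L (E y) (E z) = y \<bullet> z" "L (E y) n = 0" "L (E y) v = 0"
    and split: "X = - L X n *\<^sub>R n + L X v *\<^sub>R v + E (G X)"

text \<open>The Lorentz isometry \<open>\<Phi>\<close> below is minus the reflection in the hyperplane orthogonal to the time-like
vector \<open>n + e0\<close>. It exchanges \<open>n\<close> with the time axis \<open>e0\<close>, so that \<open>v\<close> becomes a space vector \<open>w\<close>. A
linear isometry of 3-space onto the orthogonal complement of \<open>w\<close> in the 4-dimensional space part then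
gives the rest of the frame.\<close>

lemma sphere_chart_exists:
  assumes n: "L n n = -1" "snd n > 0" and v: "L v v = 1" "L n v = 0"
  obtains E G where "sphere_chart n v E G"
proof -
  define e0 :: lorentz_space where "e0 = (0, 1)"
  define u where "u = n + e0"
  have e0: "L X e0 = - snd X" "L e0 X = - snd X" for X by (simp_all add: e0_def lorentz_form_def)
  have s0: "snd e0 = 1" by (simp add: e0_def)
  have nu: "L n u = L u u / 2" by (simp add: u_def e0 n s0)
  have "L u u = - 2 - 2 * snd n" by (simp add: u_def e0 n s0)
  then have uu: "L u u \<noteq> 0" using n(2) by linarith
  define \<Phi> where "\<Phi> X = (2 * L X u / L u u) *\<^sub>R u - X" for X
  have lin: "linear \<Phi>" unfolding \<Phi>_def
    by (intro linearI) (simp_all add: algebra_simps add_divide_distrib)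
  have inv: "\<Phi> (\<Phi> X) = X" for X
    using uu by (simp add: \<Phi>_def)
  have iso: "L (\<Phi> X) (\<Phi> Y) = L X Y" for X Y
    using uu by (simp add: \<Phi>_def L_commute[of u Y] field_simps)
  have "2 * L n u / L u u = 1" using nu uu by simp
  then have "\<Phi> n = u - n" unfolding \<Phi>_def by (simp only:) simp
  then have \<Phi>n: "\<Phi> n = e0" by (simp add: u_def)
  have adj: "L (\<Phi> X) Y = L X (\<Phi> Y)" for X Y using iso[of X "\<Phi> Y"] by (simp add: inv)
  define w where "w = fst (\<Phi> v)"
  have "snd (\<Phi> v) = - L (\<Phi> v) (\<Phi> n)" by (simp add: \<Phi>n e0)
  then have sv: "snd (\<Phi> v) = 0" by (simp add: iso L_commute[of v n] v)
  then have \<Phi>v: "\<Phi> v = (w, 0)" by (simp add: w_def prod_eq_iff)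
  have ww: "w \<bullet> w = 1" using iso[of v v] v \<Phi>v by (simp add: lorentz_form_def)
  define W where "W = {x. w \<bullet> x = 0}"
  have "w \<noteq> 0" using ww by auto
  then have "dim W = dim (UNIV :: (real^3) set)"
    unfolding W_def by (simp add: dim_hyperplane)
  moreover have "subspace W" by (simp add: W_def subspace_hyperplane)
  ultimately obtain f g where f: "linear f" "linear g" "f ` (UNIV :: (real^3) set) = W" 
    "\<And>x. norm (f x) = norm x" "\<And>x. x \<in> W \<Longrightarrow> f (g x) = x"
    using isometries_subspaces[of "UNIV :: (real^3) set" W] by (metis UNIV_I subspace_UNIV)
  have fin: "f y \<bullet> f z = y \<bullet> z" for y z
    by (simp add: dot_norm f(4) flip: linear_add[OF f(1)])
  have fw: "f y \<bullet> w = 0" for y using f(3) by (auto simp: W_def inner_commute)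
  define E :: "real^3 \<Rightarrow> lorentz_space" where "E y = \<Phi> (f y, 0)" for y
  define q where "q X = fst (\<Phi> X) - (w \<bullet> fst (\<Phi> X)) *\<^sub>R w" for X
  define G where "G X = g (q X)" for X
  have lE: "linear E" unfolding E_def
    by (intro linearI; subst linear_add[OF lin, symmetric] linear_scale[OF lin, symmetric])
      (simp_all add: linear_add[OF f(1)] linear_scale[OF f(1)])
  have lG: "linear G" unfolding G_def q_def
    by (intro linearI) (simp_all add: linear_add[OF f(2), symmetric] linear_scale[OF f(2), symmetric]
        linear_add[OF lin] linear_scale[OF lin] inner_add_right algebra_simps)
  have "X = - L X n *\<^sub>R n + L X v *\<^sub>R v + E (G X)" for X
  proof -
    have qW: "q X \<in> W" by (simp add: W_def q_def inner_diff_right ww)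
    have a: "w \<bullet> fst (\<Phi> X) = L X v" using iso[of X v] by (simp add: \<Phi>v lorentz_form_def inner_commute)
    have s: "snd (\<Phi> X) = - L X n" using iso[of X n] by (simp add: \<Phi>n e0)
    have "\<Phi> X = - L X n *\<^sub>R \<Phi> n + L X v *\<^sub>R \<Phi> v + (f (G X), 0)"
    proof -
      have "f (G X) = q X" using f(5)[OF qW] by (simp add: G_def)
      then have "f (G X) = fst (\<Phi> X) - L X v *\<^sub>R w" by (simp add: q_def a)
      then show ?thesis using s by (simp add: \<Phi>n \<Phi>v e0_def prod_eq_iff)
    qed
    then have "\<Phi> (\<Phi> X) = \<Phi> (- L X n *\<^sub>R \<Phi> n + L X v *\<^sub>R \<Phi> v + (f (G X), 0))" by simp
    then show ?thesis
      by (simp add: linear_add[OF lin] linear_diff[OF lin] linear_scale[OF lin] inv E_def del: scaleR_Pair)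
  qed
  moreover have "L (E y) (E z) = y \<bullet> z" for y z
    by (simp add: E_def iso) (simp add: lorentz_form_def fin)
  moreover have "L (E y) n = 0" for y
    by (simp add: E_def adj \<Phi>n e0)
  moreover have "L (E y) v = 0" for y
    by (simp add: E_def adj \<Phi>v) (simp add: lorentz_form_def fw)
  ultimately have "sphere_chart n v E G"
    unfolding sphere_chart_def using n v lE lG by blast
  then show thesis by (rule that)
qed

definition cap :: "lorentz_space \<Rightarrow> ((real^3) \<times> real) set" where
  "cap v = {\<xi> \<in> S3. L v (\<xi>, 1) \<ge> 0}"

definition open_cap :: "lorentz_space \<Rightarrow> ((real^3) \<times> real) set" where
  "open_cap v = {\<xi> \<in> S3. L v (\<xi>, 1) > 0}"

definition sphere_of :: "lorentz_space \<Rightarrow> ((real^3) \<times> real) set" where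
  "sphere_of v = {\<xi> \<in> S3. L v (\<xi>, 1) = 0}"

definition shell :: "lorentz_space \<Rightarrow> lorentz_space \<Rightarrow> ((real^3) \<times> real) set" where
  "shell v w = {\<xi> \<in> S3. L v (\<xi>, 1) \<le> 0 \<and> L w (\<xi>, 1) \<le> 0}"

definition open_shell :: "lorentz_space \<Rightarrow> lorentz_space \<Rightarrow> ((real^3) \<times> real) set" where
  "open_shell v w = {\<xi> \<in> S3. L v (\<xi>, 1) < 0 \<and> L w (\<xi>, 1) < 0}"

context sphere_chart
begin

lemma comm: "L v n = 0" "L n (E y) = 0" "L v (E y) = 0"
  using nv E L_commute by metis+

text \<open>The light-like vectors of the cone, parametrised by inverse stereographic projection in the frame.
The unit sphere corresponds to the vectors that are orthogonal to \<open>v\<close>.\<close>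

definition ray :: "real^3 \<Rightarrow> lorentz_space" where
  "ray z = ((z \<bullet> z + 1) / 2) *\<^sub>R n - ((z \<bullet> z - 1) / 2) *\<^sub>R v + E z"

definition chart :: "real^3 \<Rightarrow> (real^3) \<times> real" where
  "chart z = fst (ray z) /\<^sub>R snd (ray z)"

text \<open>The linear functional that is 1 on all vectors \<open>ray z\<close>. On the light cone it vanishes only on the
multiples of \<open>n - v\<close>, which represent the point that the chart misses.\<close>

definition scale :: "lorentz_space \<Rightarrow> real" where
  "scale X = L X v - L X n"

definition coord :: "(real^3) \<times> real \<Rightarrow> real^3" where
  "coord \<xi> = G (\<xi>, 1) /\<^sub>R scale (\<xi>, 1)"

lemma L_ray: "L (ray z) n = - ((z \<bullet> z + 1) / 2)" "L (ray z) v = - ((z \<bullet> z - 1) / 2)"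
    "L n (ray z) = - ((z \<bullet> z + 1) / 2)" "L v (ray z) = - ((z \<bullet> z - 1) / 2)"
  "L (ray z) (ray z) = 0"
  by (simp_all add: ray_def n v nv comm E field_simps power2_eq_square)

lemma snd_ray: "snd (ray z) > 0"
proof (rule future_if_L_neg)
  show "L n (ray z) < 0" by (simp add: L_ray add_nonneg_pos)
qed (simp_all add: n L_ray)

lemma chart_ray: "(chart z, 1) = ray z /\<^sub>R snd (ray z)"
  using snd_ray[of z] by (simp add: chart_def prod_eq_iff)

lemma chart_in_S3: "chart z \<in> S3"
proof -
  have "L (chart z, 1) (chart z, 1) = 0" unfolding chart_ray by (simp add: L_ray)
  then show ?thesis by (simp add: L_eq_norm S3_def abs_square_eq_1)
qed

lemma L_chart_sign: "sgn (L w (chart z, 1)) = sgn (L w (ray z))"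
  unfolding chart_ray using snd_ray[of z] by (simp add: sgn_mult)

lemma E_G: "E (G X) = X + L X n *\<^sub>R n - L X v *\<^sub>R v"
proof -
  have "e = x + c *\<^sub>R n - d *\<^sub>R v" if "x = - c *\<^sub>R n + d *\<^sub>R v + e" for x e c d
    by (simp add: that)
  then show ?thesis using split by blast
qed

lemma G_ray: "G (ray z) = z"
proof -
  have "E (G (ray z)) = E z" unfolding E_G L_ray by (simp add: ray_def)
  then have "E (G (ray z) - z) = 0" by (simp add: linear_diff[OF linear_E])
  then show ?thesis using E(1)[of "G (ray z) - z" "G (ray z) - z"] by simp
qed

lemma scale_ray: "scale (ray z) = 1"
  by (simp add: scale_def L_ray field_simps)

lemma scale_chart: "scale (chart z, 1) = inverse (snd (ray z))"
  unfolding chart_ray using scale_ray[of z] by (simp add: scale_def flip: right_diff_distrib)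

lemma coord_chart: "coord (chart z) = z"
  unfolding coord_def scale_chart unfolding chart_ray
  using snd_ray[of z] by (simp add: linear_scale[OF linear_G] G_ray del: scaleR_Pair)

lemma null_split: "L X X = 0 \<Longrightarrow> G X \<bullet> G X = (L X n)\<^sup>2 - (L X v)\<^sup>2"
proof -
  assume X: "L X X = 0"
  have "L X X = L X (- L X n *\<^sub>R n + L X v *\<^sub>R v + E (G X))" using split[of X] by simp
  also have "\<dots> = - (L X n)\<^sup>2 + (L X v)\<^sup>2 + L X (E (G X))" by (simp add: power2_eq_square)
  also have "L X (E (G X)) = L (- L X n *\<^sub>R n + L X v *\<^sub>R v + E (G X)) (E (G X))" using split[of X] by simp
  also have "\<dots> = G X \<bullet> G X" by (simp add: comm E)
  finally show ?thesis using X by simp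
qed

lemma chart_coord:
  assumes "\<xi> \<in> S3" "scale (\<xi>, 1) > 0" shows "chart (coord \<xi>) = \<xi>"
proof -
  define X :: lorentz_space where "X = (\<xi>, 1)"
  define \<alpha> \<beta> where "\<alpha> = L X v" and "\<beta> = - L X n"
  have d: "\<alpha> + \<beta> > 0" using assms by (simp add: scale_def X_def \<alpha>_def \<beta>_def)
  define z where "z = G X /\<^sub>R (\<alpha> + \<beta>)"
  have z: "coord \<xi> = z" by (simp add: coord_def z_def scale_def \<alpha>_def \<beta>_def X_def)
  have "L X X = 0" using L_lightlike assms by (simp add: X_def)
  then have GG: "G X \<bullet> G X = (\<beta> - \<alpha>) * (\<alpha> + \<beta>)"
    using null_split by (simp add: \<alpha>_def \<beta>_def power2_eq_square algebra_simps)
  have zz: "z \<bullet> z = (\<beta> - \<alpha>) / (\<alpha> + \<beta>)"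
    using d by (simp add: z_def GG power2_eq_square divide_inverse)
  have "ray z = (\<beta> / (\<alpha> + \<beta>)) *\<^sub>R n + (\<alpha> / (\<alpha> + \<beta>)) *\<^sub>R v + E z"
  proof -
    have *: "(z \<bullet> z + 1) / 2 = \<beta> / (\<alpha> + \<beta>)" "(z \<bullet> z - 1) / 2 = - \<alpha> / (\<alpha> + \<beta>)"
      using d by (simp_all add: zz field_simps)
    show ?thesis unfolding ray_def * by simp
  qed
  also have "\<dots> = (\<beta> *\<^sub>R n + \<alpha> *\<^sub>R v + E (G X)) /\<^sub>R (\<alpha> + \<beta>)"
    by (simp add: z_def linear_scale[OF linear_E] scaleR_add_right divide_inverse mult.commute)
  also have "\<dots> = X /\<^sub>R (\<alpha> + \<beta>)" using split[of X] by (simp add: \<alpha>_def \<beta>_def)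
  finally show ?thesis using d by (simp add: chart_def z X_def)
qed

text \<open>The second alternative describes the point missed by the chart.\<close>

lemma scale_cases:
  assumes "\<xi> \<in> S3"
  shows "scale (\<xi>, 1) > 0 \<or> (L n (\<xi>, 1) < 0 \<and> L v (\<xi>, 1) = L n (\<xi>, 1))"
proof -
  define X :: lorentz_space where "X = (\<xi>, 1)"
  have X: "L X X = 0" "snd X = 1" using L_lightlike assms by (auto simp: X_def)
  have c: "L X n = L n X" "L X v = L v X" by (auto simp: L_commute)
  have neg: "L n X < 0" using X n by (intro L_future_neg[of n X]) auto
  have "(L v X)\<^sup>2 \<le> (L n X)\<^sup>2" using null_split[OF X(1)] inner_ge_zero[of "G X"] by (simp add: c)
  then have "\<bar>L v X\<bar> \<le> \<bar>L n X\<bar>" by (simp add: abs_le_square_iff)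
  then show ?thesis using neg by (auto simp: scale_def c X_def[symmetric])
qed

lemma chart_cover:
  assumes "\<xi> \<in> S3" "L v (\<xi>, 1) \<ge> 0"
  obtains z where "\<xi> = chart z"
  using scale_cases[OF assms(1)] chart_coord[OF assms(1)] assms(2) by (metis linorder_not_le)

lemma chart_v_sign: "sgn (L v (chart z, 1)) = sgn (1 - norm z)"
proof -
  have "sgn (L v (chart z, 1)) = sgn (1 - z \<bullet> z)" 
  proof -
    have "L v (ray z) = (1 - z \<bullet> z) * (1 / 2)" by (simp add: L_ray field_simps)
    then show ?thesis by (simp only: L_chart_sign sgn_mult) simp
  qed
  also have "1 - z \<bullet> z = (1 - norm z) * (1 + norm z)"
    by (simp add: algebra_simps dot_square_norm power2_eq_square)
  also have "sgn \<dots> = sgn (1 - norm z)"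
  proof -
    have "sgn (1 + norm z) = 1" by (simp add: add_pos_nonneg)
    then show ?thesis by (simp only: sgn_mult mult_1_right)
  qed
  finally show ?thesis .
qed

lemma cap_chart: "cap v = chart ` cball 0 1" "open_cap v = chart ` ball 0 1"
  "sphere_of v = chart ` sphere 0 1"
proof -
  have "0 \<le> L v (chart z, 1) \<longleftrightarrow> norm z \<le> 1" "0 < L v (chart z, 1) \<longleftrightarrow> norm z < 1"
    "L v (chart z, 1) = 0 \<longleftrightarrow> norm z = 1" for z
    using chart_v_sign[of z] by (auto simp: sgn_if split: if_splits)
  note * = this
  show "cap v = chart ` cball 0 1" "open_cap v = chart ` ball 0 1"
    "sphere_of v = chart ` sphere 0 1"
    unfolding cap_def open_cap_def sphere_of_def
    by (auto simp: * chart_in_S3 image_iff elim!: chart_cover intro: less_imp_le)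
qed

lemma C_on_ray:
  assumes "open U" "C_on k h U" shows "C_on k (\<lambda>p. ray (h p)) U"
proof -
  have "C_on k (\<lambda>p. ((h p \<bullet> h p + 1) * (1 / 2)) *\<^sub>R n + ((h p \<bullet> h p + (- 1)) * (- 1 / 2)) *\<^sub>R v + E (h p)) U"
    using assms linear_E by (intro C_on_intros C_on_linear_comp[of E]) (auto simp: linear_conv_bounded_linear)
  then show ?thesis by (simp add: ray_def)
qed

lemma C_on_chart:
  assumes "open U" "C_on k h U" shows "C_on k (\<lambda>p. chart (h p)) U"
proof -
  have "C_on k (\<lambda>p. (snd (ray (h p)) powr - 1) *\<^sub>R fst (ray (h p))) U"
    using assms snd_ray
    by (intro C_on_intros C_on_powr C_on_linear_comp[of snd] C_on_linear_comp[of fst] C_on_ray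
        bounded_linear_fst bounded_linear_snd) auto
  then show ?thesis
    using snd_ray by (simp add: chart_def powr_minus order_less_imp_le)
qed

lemma continuous_on_chart: "continuous_on S chart"
  using C_on_chart[of UNIV 0 "\<lambda>x. x"] continuous_on_subset[of UNIV chart S] by simp

end

section \<open>The region between two disjoint spheres\<close>

text \<open>With \<open>m = cosh \<rho>\<close>, the second sphere belongs to the unit vector \<open>sinh \<rho> n - cosh \<rho> v\<close>. In the chart it is
the sphere of radius \<open>R = exp \<rho>\<close>, concentric with the unit sphere, which belongs to \<open>v\<close>.\<close>

locale spherical_shell = sphere_chart +
  fixes m :: real
  assumes m: "m > 1"
begin

definition outer :: lorentz_space where
  "outer = sqrt (m\<^sup>2 - 1) *\<^sub>R n - m *\<^sub>R v"

definition R :: real where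
  "R = m + sqrt (m\<^sup>2 - 1)"

lemma R_gt_1: "R > 1"
proof -
  have "m\<^sup>2 > 1" using m by (simp add: one_less_power)
  then have "sqrt (m\<^sup>2 - 1) \<ge> 0" by simp
  then show ?thesis using m unfolding R_def by linarith
qed

lemma chart_outer_sign: "sgn (L outer (chart z, 1)) = sgn (norm z - R)"
proof -
  define s where "s = sqrt (m\<^sup>2 - 1)"
  have "m\<^sup>2 > 1" using m by (simp add: one_less_power)
  then have ss: "s * s = m * m - 1" by (simp add: s_def power2_eq_square)
  have R: "R = m + s" by (simp add: R_def s_def)
  have "(m - s) * R = 1" by (simp add: R ss algebra_simps)
  then have ms: "m - s = 1 / R" using R_gt_1 by (simp add: field_simps)
  have "L outer (ray z) = ((m - s) * (z \<bullet> z) - R) / 2"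
    by (simp add: outer_def L_ray s_def[symmetric] R field_simps)
  also have "\<dots> = (norm z - R) * ((norm z + R) / (2 * R))"
    unfolding ms using R_gt_1 by (simp add: field_simps dot_square_norm power2_eq_square)
  finally have "L outer (ray z) = (norm z - R) * ((norm z + R) / (2 * R))" .
  moreover have "sgn ((norm z + R) / (2 * R)) = 1"
    using R_gt_1 by (intro sgn_pos divide_pos_pos add_nonneg_pos) auto
  ultimately show ?thesis by (simp only: L_chart_sign sgn_mult mult_1_right)
qed

lemma chart_in_shell:
  "chart z \<in> shell v outer \<longleftrightarrow> 1 \<le> norm z \<and> norm z \<le> R"
  "chart z \<in> open_shell v outer \<longleftrightarrow> 1 < norm z \<and> norm z < R"
proof -
  have "L v (chart z, 1) \<le> 0 \<longleftrightarrow> 1 \<le> norm z" "L v (chart z, 1) < 0 \<longleftrightarrow> 1 < norm z"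
    using chart_v_sign[of z] by (auto simp: sgn_if split: if_splits)
  moreover have "L outer (chart z, 1) \<le> 0 \<longleftrightarrow> norm z \<le> R" "L outer (chart z, 1) < 0 \<longleftrightarrow> norm z < R"
    using chart_outer_sign[of z] by (auto simp: sgn_if split: if_splits)
  ultimately show "chart z \<in> shell v outer \<longleftrightarrow> 1 \<le> norm z \<and> norm z \<le> R"
    "chart z \<in> open_shell v outer \<longleftrightarrow> 1 < norm z \<and> norm z < R"
    by (auto simp: shell_def open_shell_def chart_in_S3)
qed

text \<open>The point missed by the chart lies strictly beyond the outer sphere.\<close>

lemma scale_pos:
  assumes "\<xi> \<in> S3" "L outer (\<xi>, 1) \<le> 0"
  shows "scale (\<xi>, 1) > 0"
proof (rule ccontr)
  define s where "s = sqrt (m\<^sup>2 - 1)"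
  have sm: "s < m" using m real_sqrt_less_mono[of "m\<^sup>2 - 1" "m\<^sup>2"] by (simp add: s_def)
  assume "\<not> scale (\<xi>, 1) > 0"
  then have e: "L n (\<xi>, 1) < 0" "L v (\<xi>, 1) = L n (\<xi>, 1)" using scale_cases[OF assms(1)] by auto
  have "L outer (\<xi>, 1) = (s - m) * L n (\<xi>, 1)"
    by (simp add: outer_def s_def[symmetric] e algebra_simps)
  then have "L outer (\<xi>, 1) > 0" using sm e by (simp add: mult_neg_neg)
  then show False using assms by simp
qed

lemma shell_chart:
  "shell v outer = chart ` {z. 1 \<le> norm z \<and> norm z \<le> R}"
  "open_shell v outer = chart ` {z. 1 < norm z \<and> norm z < R}"
proof -
  have "\<exists>z. \<xi> = chart z" if "\<xi> \<in> shell v outer \<or> \<xi> \<in> open_shell v outer" for \<xi>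
  proof -
    have \<xi>: "\<xi> \<in> S3" "L outer (\<xi>, 1) \<le> 0"
      using that by (auto simp: shell_def open_shell_def)
    then show ?thesis using chart_coord[OF \<xi>(1) scale_pos[OF \<xi>]] by metis
  qed
  note * = this
  have "S = chart ` {z. P z}" if "\<And>z. chart z \<in> S \<longleftrightarrow> P z" "\<And>\<xi>. \<xi> \<in> S \<Longrightarrow> \<exists>z. \<xi> = chart z" for S P
    using that by (auto simp: image_iff) metis
  note ** = this
  show "shell v outer = chart ` {z. 1 \<le> norm z \<and> norm z \<le> R}"
    by (rule **) (use chart_in_shell(1) * in blast)+
  show "open_shell v outer = chart ` {z. 1 < norm z \<and> norm z < R}"
    by (rule **) (use chart_in_shell(2) * in blast)+
qed

lemma compact_shell: "compact (shell v outer)"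
proof -
  have "{z::real^3. 1 \<le> norm z \<and> norm z \<le> R} = cball 0 R - ball 0 1" by auto
  then have "compact {z::real^3. 1 \<le> norm z \<and> norm z \<le> R}" by (simp add: compact_diff)
  then show ?thesis unfolding shell_chart using continuous_on_chart compact_continuous_image by blast
qed

lemma connected_open_shell: "connected (open_shell v outer)"
proof -
  have "connected {z::real^3. 1 < norm z \<and> norm z < R}"
    using connected_annulus(1)[where ?r1.0 = 1 and ?r2.0 = R and a = "0::real^3"] by simp
  then show ?thesis unfolding shell_chart using continuous_on_chart connected_continuous_image by blast
qed

text \<open>The chart is continuous, so the preimage of the interior is an open subset of the closed Euclidean
shell, and hence is contained in the open one.\<close>

lemma interior_shell: "top_of_set S3 interior_of shell v outer = open_shell v outer"
proof
  let ?I = "top_of_set S3 interior_of shell v outer"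
  have "openin (top_of_set S3) (open_shell v outer)"
  proof -
    have "open_shell v outer = S3 \<inter> {\<xi>. L v (\<xi>, 1) < 0 \<and> L outer (\<xi>, 1) < 0}"
      by (auto simp: open_shell_def)
    moreover have "open {\<xi>. L v (\<xi>, 1) < 0 \<and> L outer (\<xi>, 1) < 0}"
      unfolding lorentz_form_def by (intro open_Collect_conj open_Collect_less continuous_intros)
    ultimately show ?thesis by (simp add: openin_open_Int)
  qed
  then show "open_shell v outer \<subseteq> ?I"
    by (intro interior_of_maximal) (auto simp: shell_def open_shell_def)
  show "?I \<subseteq> open_shell v outer"
  proof
    fix \<xi> assume \<xi>: "\<xi> \<in> ?I"
    then have "\<xi> \<in> shell v outer" by (rule subsetD[OF interior_of_subset])
    then obtain z where z: "\<xi> = chart z" unfolding shell_chart by blast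
    have "openin (top_of_set UNIV) (UNIV \<inter> chart -` ?I)"
      by (rule continuous_openin_preimage[OF continuous_on_chart _ openin_interior_of])
        (auto simp: chart_in_S3)
    then have "open (chart -` ?I)" by simp
    moreover have "chart -` ?I \<subseteq> cball 0 R \<inter> - ball 0 1"
    proof
      fix y assume "y \<in> chart -` ?I"
      then have "chart y \<in> ?I" by simp
      then have "chart y \<in> shell v outer" by (rule subsetD[OF interior_of_subset])
      then show "y \<in> cball 0 R \<inter> - ball 0 1" unfolding chart_in_shell by simp
    qed
    ultimately have "chart -` ?I \<subseteq> interior (cball 0 R \<inter> - ball 0 1)"
      by (rule interior_maximal[rotated])
    also have "\<dots> = ball 0 R \<inter> - cball 0 1"
      by (simp add: interior_Int interior_complement)
    finally have "chart -` ?I \<subseteq> ball 0 R \<inter> - cball 0 1" .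
    then show "\<xi> \<in> open_shell v outer"
      using \<xi> unfolding z chart_in_shell(2) by auto
  qed
qed

text \<open>Interpolating the radius linearly between 1 and \<open>R\<close> avoids exponentials: \<open>g\<close> is rational, and \<open>f\<close>
involves only division and the norm away from the origin.\<close>

lemma diffeomorphic_shell: "diffeomorphic (shell v outer) (sphere (0::real^3) 1 \<times> {0..1::real})"
proof -
  let ?T = "sphere (0::real^3) 1 \<times> {0..1::real}"
  define g where "g p = chart ((1 + snd p * (R - 1)) *\<^sub>R fst p)" for p
  define f where "f \<xi> = (coord \<xi> /\<^sub>R norm (coord \<xi>), (norm (coord \<xi>) - 1) / (R - 1))" for \<xi>
  have "C_on k g UNIV" for k
  proof -
    have "C_on k (\<lambda>p. chart ((1 + snd p * (R - 1)) *\<^sub>R fst p)) (UNIV :: ((real^3) \<times> real) set)"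
      by (intro C_on_chart C_on_intros C_on_bounded_linear bounded_linear_fst bounded_linear_snd) auto
    then show ?thesis by (simp add: g_def[abs_def])
  qed
  then have g: "smooth_map_on ?T g" by (intro smooth_map_onI[of UNIV]) auto
  define X :: "(real^3) \<times> real \<Rightarrow> lorentz_space" where "X \<xi> = (\<xi>, 1)" for \<xi>
  define U where "U = {\<xi>. scale (X \<xi>) > 0} \<inter> {\<xi>. G (X \<xi>) \<bullet> G (X \<xi>) > 0}"
  have CX: "C_on k X V" if "open V" for k V
    unfolding X_def[abs_def] using that by (intro C_on_intros C_on_bounded_linear bounded_linear_ident)
  have CG: "C_on k (\<lambda>\<xi>. G (X \<xi>)) V" if "open V" for k V
    using that linear_G C_on_linear_comp[of G V k X] CX by (simp add: linear_conv_bounded_linear)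
  have Cs: "C_on k (\<lambda>\<xi>. scale (X \<xi>)) V" if "open V" for k V
  proof -
    have "linear scale" by (rule linearI) (simp_all add: scale_def algebra_simps)
    then show ?thesis
      using that C_on_linear_comp[of scale V k X] CX by (simp add: linear_conv_bounded_linear)
  qed
  have "open U"
  proof -
    have "continuous_on UNIV (\<lambda>\<xi>. scale (X \<xi>))" "continuous_on UNIV (\<lambda>\<xi>. G (X \<xi>) \<bullet> G (X \<xi>))"
      using Cs[of UNIV 0] C_on_inner[OF _ CG CG, of UNIV 0] by auto
    then show ?thesis unfolding U_def by (intro open_Int open_Collect_less continuous_on_const)
  qed
  have sU: "shell v outer \<subseteq> U"
  proof
    fix \<xi> assume "\<xi> \<in> shell v outer"
    then obtain z where "\<xi> = chart z" "1 \<le> norm z" unfolding shell_chart by blast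
    moreover have "X (chart z) = ray z /\<^sub>R snd (ray z)" for z by (simp add: X_def chart_ray)
    ultimately show "\<xi> \<in> U"
      using snd_ray[of z] scale_chart[of z]
      by (auto simp: U_def linear_scale[OF linear_G] G_ray X_def[symmetric])
  qed
  \<comment> \<open>the same map as \<open>f\<close> on the shell, written with powers to fit the smoothness rules\<close>
  define F where "F \<xi> = ((G (X \<xi>) \<bullet> G (X \<xi>)) powr (- 1 / 2) *\<^sub>R G (X \<xi>),
     ((G (X \<xi>) \<bullet> G (X \<xi>)) powr (1 / 2) * scale (X \<xi>) powr - 1 + (- 1)) * (1 / (R - 1)))" for \<xi>
  have "C_on k F U" for k
    unfolding F_def[abs_def] using \<open>open U\<close>
    by (intro C_on_intros C_on_powr CG Cs) (auto simp: U_def)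
  moreover have "F \<xi> = f \<xi>" if "\<xi> \<in> shell v outer" for \<xi>
  proof -
    have s: "scale (X \<xi>) > 0" and G: "G (X \<xi>) \<bullet> G (X \<xi>) > 0" using that sU by (auto simp: U_def)
    have "(G (X \<xi>) \<bullet> G (X \<xi>)) powr (1 / 2) = norm (G (X \<xi>))"
      using G by (simp add: powr_half_sqrt norm_eq_sqrt_inner)
    moreover from this have "(G (X \<xi>) \<bullet> G (X \<xi>)) powr (- 1 / 2) = inverse (norm (G (X \<xi>)))"
      by (simp add: powr_minus)
    ultimately show ?thesis
      using s G by (simp add: F_def f_def coord_def X_def[symmetric] powr_minus field_simps)
  qed
  ultimately have f: "smooth_map_on (shell v outer) f"
    using \<open>open U\<close> sU by (intro smooth_map_onI[of U _ F]) auto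
  have R: "R - 1 > 0" using R_gt_1 by simp
  have "homeomorphism (shell v outer) ?T f g"
  proof (rule homeomorphismI)
    show "continuous_on (shell v outer) f" "continuous_on ?T g"
      using f g smooth_map_on_imp_continuous_on by auto
    show "f ` shell v outer \<subseteq> ?T"
      unfolding shell_chart f_def using R by (auto simp: coord_chart field_simps)
    show "g ` ?T \<subseteq> shell v outer"
    proof
      fix \<xi> assume "\<xi> \<in> g ` ?T"
      then obtain y \<tau> where \<xi>: "\<xi> = g (y, \<tau>)" "norm y = 1" "0 \<le> \<tau>" "\<tau> \<le> 1" by auto
      have "0 \<le> \<tau> * (R - 1)" "\<tau> * (R - 1) \<le> 1 * (R - 1)" 
        using R \<xi> by (auto intro!: mult_right_mono)
      then show "\<xi> \<in> shell v outer" unfolding \<xi>(1) g_def chart_in_shell by (simp add: \<xi>(2))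
    qed
    show "g (f \<xi>) = \<xi>" if "\<xi> \<in> shell v outer" for \<xi>
    proof -
      obtain z where "\<xi> = chart z" "1 \<le> norm z" using \<open>\<xi> \<in> _\<close> unfolding shell_chart by blast
      moreover from this have "norm z * inverse (norm z) = 1" by (intro right_inverse) auto
      ultimately show ?thesis using R by (simp add: g_def f_def coord_chart)
    qed
    show "f (g p) = p" if pT: "p \<in> ?T" for p
    proof -
      obtain y \<tau> where p: "p = (y, \<tau>)" "norm y = 1" "0 \<le> \<tau>"
        using pT by (cases p) auto
      have "1 + \<tau> * (R - 1) > 0" using p(3) R by (simp add: add_pos_nonneg)
      then show ?thesis using R by (simp add: p g_def f_def coord_chart)
    qed
  qed
  then show ?thesis unfolding diffeomorphic_def using f g by blast
qed

end

section \<open>Round spheres as unit space-like vectors\<close>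

text \<open>Normalised signs for a pair of disjoint spheres. The two vectors are determined up to sign by the
spheres. The sign of \<open>L v w\<close> makes the caps \<open>cap v\<close> and \<open>cap w\<close> either disjoint or jointly covering, and
the last condition selects the disjoint ones.\<close>

definition opposite :: "real \<Rightarrow> lorentz_space \<Rightarrow> lorentz_space \<Rightarrow> bool" where
  "opposite m v w \<longleftrightarrow> L v v = 1 \<and> L w w = 1 \<and> L v w = - m \<and> m > 1 \<and> snd (v + m *\<^sub>R w) > 0"

lemma opposite_commute:
  assumes "opposite m v w" shows "opposite m w v"
proof -
  have o: "L v v = 1" "L w w = 1" "L v w = - m" "m > 1" "snd (v + m *\<^sub>R w) > 0"
    using assms by (auto simp: opposite_def)
  have c: "L w v = - m" using o L_commute by metis
  have mm: "m * m > 1" using o(4) by (simp add: less_1_mult)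
  define a b where "a = v + m *\<^sub>R w" and "b = w + m *\<^sub>R v"
  have aa: "L a a = 1 - m * m" and bb: "L b b = 1 - m * m"
    by (simp_all add: a_def b_def o c algebra_simps)
  have "L a b = m * (1 - m * m)" by (simp add: a_def b_def o c algebra_simps)
  also have "\<dots> < 0" using o(4) mm by (simp add: mult_pos_neg)
  finally have "L a b < 0" .
  then have "snd b > 0" using future_if_L_neg[of a b] aa bb mm o(5) by (simp add: a_def)
  then show ?thesis using o c by (simp add: opposite_def b_def)
qed

text \<open>The time-like vector \<open>n\<close> is the normalised part of \<open>w\<close> that is orthogonal to \<open>v\<close>; solving its
definition for \<open>w\<close> gives the formula for the outer sphere.\<close>

lemma spherical_shell_exists:
  assumes "opposite m v w"
  obtains n E G where "spherical_shell n v E G m" "spherical_shell.outer n v m = w"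
proof -
  have o: "L v v = 1" "L w w = 1" "L v w = - m" "m > 1" "snd (w + m *\<^sub>R v) > 0"
    using assms opposite_commute[OF assms] by (auto simp: opposite_def)
  have c: "L w v = - m" using o L_commute by metis
  define s where "s = sqrt (m\<^sup>2 - 1)"
  have "m\<^sup>2 > 1" using o(4) by (simp add: one_less_power)
  then have s: "s > 0" "s * s = m * m - 1" by (auto simp: s_def power2_eq_square)
  define y where "y = w + m *\<^sub>R v"
  define n where "n = y /\<^sub>R s"
  have "L y y = - (s * s)"
    by (simp add: y_def o c s(2) algebra_simps)
  then have n1: "L n n = -1" using s(1) by (simp add: n_def field_simps)
  have n2: "snd n > 0" using o(5) s(1) by (simp add: n_def y_def)
  have n3: "L n v = 0" by (simp add: n_def y_def o c)
  obtain E G where "sphere_chart n v E G"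
    using sphere_chart_exists[OF n1 n2 o(1) n3] .
  then have sp: "spherical_shell n v E G m"
    using o(4) by (simp add: spherical_shell_def spherical_shell_axioms_def)
  have "w = s *\<^sub>R n - m *\<^sub>R v" using s(1) by (simp add: n_def y_def)
  then have "spherical_shell.outer n v m = w"
    using spherical_shell.outer_def[OF sp] by (simp add: s_def)
  with sp show thesis by (rule that)
qed

lemma sphere_vector_iff: "sphere_vector v S \<longleftrightarrow> L v v = 1 \<and> S = sphere_of v"
  by (simp add: sphere_vector_def sphere_of_def)

lemma norm_divideR_square: "(norm (p /\<^sub>R k))\<^sup>2 = (norm p)\<^sup>2 / k\<^sup>2"
  by (simp add: power_mult_distrib power_inverse divide_inverse mult.commute)

lemma S3_eq: "S3 = insert infty (range stereo)"
proof -
  have "\<xi> \<in> range stereo" if "\<xi> \<in> S3" "\<xi> \<noteq> infty" for \<xi>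
  proof -
    obtain p q where \<xi>: "\<xi> = (p, q)" by force
    have pq: "(norm p)\<^sup>2 + q\<^sup>2 = 1"
      using that(1) by (simp add: S3_def \<xi> norm_Pair)
    have q: "q \<noteq> 1" using pq that(2) by (auto simp: \<xi> infty_def)
    have N: "(norm (p /\<^sub>R (1 - q)))\<^sup>2 = (1 + q) / (1 - q)"
    proof -
      have "(norm (p /\<^sub>R (1 - q)))\<^sup>2 = (norm p)\<^sup>2 / (1 - q)\<^sup>2" by (rule norm_divideR_square)
      also have "(norm p)\<^sup>2 = (1 + q) * (1 - q)" using pq by (simp add: power2_eq_square algebra_simps)
      finally show ?thesis using q by (simp add: power2_eq_square)
    qed
    have "2 / ((1 + q) / (1 - q) + 1) = 1 - q" "((1 + q) / (1 - q) - 1) / ((1 + q) / (1 - q) + 1) = q"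
      using q by (simp_all add: field_simps)
    then have "stereo (p /\<^sub>R (1 - q)) = \<xi>"
      unfolding stereo_def N using q by (simp add: \<xi>)
    then show ?thesis by blast
  qed
  moreover have "infty \<in> S3" by (simp add: S3_def infty_def norm_Pair)
  ultimately show ?thesis using stereo_in_S3 by auto
qed

lemma L_triple: "L ((a, b), c) ((a, b), c) = (norm a)\<^sup>2 + b\<^sup>2 - c\<^sup>2"
  by (simp add: lorentz_form_def inner_prod_def dot_square_norm power2_eq_square[of b] power2_eq_square[of c])

lemma L_stereo_sign: "L ((a, b), c) (stereo x, 1) = 0 \<longleftrightarrow> (b - c) * (norm x)\<^sup>2 + 2 * (a \<bullet> x) = b + c"
proof -
  have pos: "(norm x)\<^sup>2 + 1 > 0" by (simp add: add_nonneg_pos)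
  have "L ((a, b), c) (light_vector x) = ((norm x)\<^sup>2 + 1) / 2 * L ((a, b), c) (stereo x, 1)"
    by (simp add: light_vector_def del: scaleR_Pair)
  moreover have "L ((a, b), c) (light_vector x) = ((b - c) * (norm x)\<^sup>2 + 2 * (a \<bullet> x) - (b + c)) / 2"
    by (simp add: lorentz_form_def inner_prod_def light_vector_simps field_simps)
  ultimately have "(b - c) * (norm x)\<^sup>2 + 2 * (a \<bullet> x) - (b + c) = ((norm x)\<^sup>2 + 1) * L ((a, b), c) (stereo x, 1)"
    by simp
  then have "L ((a, b), c) (stereo x, 1) = 0 \<longleftrightarrow> (b - c) * (norm x)\<^sup>2 + 2 * (a \<bullet> x) - (b + c) = 0"
    using pos by simp
  then show ?thesis by simp
qed

text \<open>In the coordinates of \<open>real^3\<close>, orthogonality to a vector is a quadratic equation whose leading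
coefficient \<open>b - c\<close> vanishes precisely if the sphere passes through infinity.\<close>

lemma sphere_of_eq:
  "sphere_of ((a, b), c) = (if b = c then {infty} else {})
     \<union> stereo ` {x. (b - c) * (norm x)\<^sup>2 + 2 * (a \<bullet> x) = b + c}"
proof -
  have "L ((a, b), c) (infty, 1) = 0 \<longleftrightarrow> b = c"
    by (simp add: lorentz_form_def infty_def)
  then show ?thesis
    unfolding sphere_of_def S3_eq using L_stereo_sign[of a b c] by auto
qed

lemma sphere_eq_quadric:
  fixes a x :: "'a::real_inner"
  assumes "(norm a)\<^sup>2 + b\<^sup>2 - c\<^sup>2 = 1" "b \<noteq> c"
  shows "(b - c) * (norm x)\<^sup>2 + 2 * (a \<bullet> x) = b + c \<longleftrightarrow> x \<in> sphere (- (a /\<^sub>R (b - c))) (1 / \<bar>b - c\<bar>)"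
proof -
  define k where "k = b - c"
  have k: "k \<noteq> 0" using assms by (simp add: k_def)
  have na: "(norm a)\<^sup>2 = 1 - k * (b + c)"
    using assms(1) by (simp add: k_def power2_eq_square algebra_simps)
  have "x \<in> sphere (- (a /\<^sub>R k)) (1 / \<bar>k\<bar>) \<longleftrightarrow> norm (x + a /\<^sub>R k) = 1 / \<bar>k\<bar>"
    by (simp add: dist_norm norm_minus_commute[of _ x] norm_minus_commute[of "- (a /\<^sub>R k)" x])
  also have "\<dots> \<longleftrightarrow> (norm (x + a /\<^sub>R k))\<^sup>2 = (1 / \<bar>k\<bar>)\<^sup>2"
    by (subst power_eq_iff_eq_base) auto
  also have "(norm (x + a /\<^sub>R k))\<^sup>2 = (norm x)\<^sup>2 + 2 * (a \<bullet> x) / k + (1 - k * (b + c)) / k\<^sup>2"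
    unfolding na[symmetric] power2_norm_eq_inner
    by (simp add: inner_add_left inner_add_right inner_commute power2_eq_square divide_inverse algebra_simps)
  also have "\<dots> = (1 / \<bar>k\<bar>)\<^sup>2 \<longleftrightarrow> k * (norm x)\<^sup>2 + 2 * (a \<bullet> x) = b + c"
  proof -
    have "(1 - k * (b + c)) / k\<^sup>2 = (1 / \<bar>k\<bar>)\<^sup>2 - (b + c) / k"
      using k by (simp add: power_divide diff_divide_distrib power2_eq_square)
    then have "(norm x)\<^sup>2 + 2 * (a \<bullet> x) / k + (1 - k * (b + c)) / k\<^sup>2 = (1 / \<bar>k\<bar>)\<^sup>2
        \<longleftrightarrow> (norm x)\<^sup>2 + 2 * (a \<bullet> x) / k = (b + c) / k" by auto
    also have "\<dots> \<longleftrightarrow> k * (norm x)\<^sup>2 + 2 * (a \<bullet> x) = b + c"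
      using k by (simp add: field_simps)
    finally show ?thesis .
  qed
  finally show ?thesis by (simp add: k_def)
qed

lemma round_sphere_sphere_of:
  assumes "L v v = 1" shows "round_sphere (sphere_of v)"
proof -
  obtain a b c where v: "v = ((a, b), c)" by (metis prod.exhaust)
  have abc: "(norm a)\<^sup>2 + b\<^sup>2 - c\<^sup>2 = 1"
    using assms by (simp add: v L_triple)
  show ?thesis
  proof (cases "b = c")
    case True
    then have "{x. (b - c) * (norm x)\<^sup>2 + 2 * (a \<bullet> x) = b + c} = {x. a \<bullet> x = c}" by auto
    moreover have "a \<noteq> 0" using True abc by auto
    ultimately show ?thesis
      unfolding round_sphere_def v sphere_of_eq using True
      by (intro disjI2 exI[of _ a] exI[of _ c]) simp
  next
    case False
    then have "1 / \<bar>b - c\<bar> > 0" by simp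
    then show ?thesis
      unfolding round_sphere_def v sphere_of_eq sphere_eq_quadric[OF abc False] using False
      by (intro disjI1 exI[of _ "- (a /\<^sub>R (b - c))"] exI[of _ "1 / \<bar>b - c\<bar>"]) (simp add: sphere_def)
  qed
qed

lemma sphere_vector_exists:
  assumes "round_sphere S" obtains v where "sphere_vector v S"
  using assms unfolding round_sphere_def
proof (elim disjE exE conjE)
  fix p r assume r: "r > (0::real)" and S: "S = stereo ` sphere p r"
  define a where "a = - (p /\<^sub>R r)"
  define k where "k = 1 / r"
  define d where "d = r - (norm p)\<^sup>2 / r"
  have k: "k > 0" using r by (simp add: k_def)
  have na: "(norm a)\<^sup>2 = (norm p)\<^sup>2 / (r * r)"
    unfolding a_def norm_minus_cancel norm_divideR_square by (simp add: power2_eq_square)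
  have abc: "(norm a)\<^sup>2 + ((d + k) / 2)\<^sup>2 - ((d - k) / 2)\<^sup>2 = 1"
  proof -
    have "((d + k) / 2)\<^sup>2 - ((d - k) / 2)\<^sup>2 = d * k" by (simp add: power2_eq_square field_simps)
    also have "d * k = 1 - (norm a)\<^sup>2" unfolding na using r by (simp add: d_def k_def field_simps)
    finally show ?thesis by simp
  qed
  have bc: "(d + k) / 2 - (d - k) / 2 = k" by (simp add: field_simps)
  have ne: "(d + k) / 2 \<noteq> (d - k) / 2" using k by simp
  have "sphere_vector ((a, (d + k) / 2), (d - k) / 2) S"
    unfolding sphere_vector_iff
  proof
    show "L ((a, (d + k) / 2), (d - k) / 2) ((a, (d + k) / 2), (d - k) / 2) = 1"
      using abc by (simp add: L_triple)
    have pr: "- (a /\<^sub>R k) = p" "1 / \<bar>k\<bar> = r" using r by (auto simp: a_def k_def)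
    show "S = sphere_of ((a, (d + k) / 2), (d - k) / 2)"
      unfolding sphere_of_eq sphere_eq_quadric[OF abc ne] unfolding bc pr S using ne by (simp add: sphere_def)
  qed
  then show thesis by (rule that)
next
  fix u b assume u: "u \<noteq> 0" and S: "S = insert infty (stereo ` {x. u \<bullet> x = b})"
  have "sphere_vector ((u /\<^sub>R norm u, b / norm u), b / norm u) S"
    unfolding sphere_vector_iff
  proof
    show "L ((u /\<^sub>R norm u, b / norm u), b / norm u) ((u /\<^sub>R norm u, b / norm u), b / norm u) = 1"
      using u by (simp add: L_triple)
    have "{x. u \<bullet> x = b} = {x. (b / norm u - b / norm u) * (norm x)\<^sup>2 + 2 * ((u /\<^sub>R norm u) \<bullet> x) = b / norm u + b / norm u}"
      using u by (simp add: field_simps)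
    then show "S = sphere_of ((u /\<^sub>R norm u, b / norm u), b / norm u)"
      unfolding sphere_of_eq S by simp
  qed
  then show thesis by (rule that)
qed

section \<open>Zones and their complements\<close>

lemma opposite_shell_topology:
  assumes "opposite m v w"
  shows "connected (cap v)" "connected (open_cap v)" "sphere_of v \<noteq> {}" "connected (open_shell v w)"
    "compact (shell v w)" "top_of_set S3 interior_of shell v w = open_shell v w"
    "diffeomorphic (shell v w) (sphere (0::real^3) 1 \<times> {0..1::real})"
proof -
  obtain n E G where sp: "spherical_shell n v E G m" and w: "spherical_shell.outer n v m = w"
    using spherical_shell_exists[OF assms] .
  interpret spherical_shell n v E G m by (rule sp)
  show "connected (cap v)" "connected (open_cap v)"
    unfolding cap_chart by (intro connected_continuous_image continuous_on_chart; simp)+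
  show "sphere_of v \<noteq> {}"
    unfolding cap_chart by simp
  show "connected (open_shell v w)" "compact (shell v w)"
    "top_of_set S3 interior_of shell v w = open_shell v w"
    "diffeomorphic (shell v w) (sphere (0::real^3) 1 \<times> {0..1::real})"
    unfolding w[symmetric]
    by (rule connected_open_shell compact_shell interior_shell diffeomorphic_shell)+
qed

text \<open>A light-like vector in both caps would have nonnegative product with the future time-like vector
\<open>v + m w\<close>.\<close>

lemma opposite_caps_disjoint:
  assumes "opposite m v w" shows "cap v \<inter> cap w = {}"
proof (rule ccontr)
  assume "cap v \<inter> cap w \<noteq> {}"
  then obtain \<xi> where \<xi>: "\<xi> \<in> S3" "L v (\<xi>, 1) \<ge> 0" "L w (\<xi>, 1) \<ge> 0" by (auto simp: cap_def)
  have o: "L v v = 1" "L w w = 1" "L v w = - m" "m > 1" "snd (v + m *\<^sub>R w) > 0"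
    using assms by (auto simp: opposite_def)
  have c: "L w v = - m" using o L_commute by metis
  have mm: "m * m > 1" using o(4) by (simp add: less_1_mult)
  have "L (v + m *\<^sub>R w) (v + m *\<^sub>R w) = 1 - m * m" by (simp add: o c algebra_simps)
  then have "L (v + m *\<^sub>R w) (\<xi>, 1) < 0"
    using L_future_neg[of "v + m *\<^sub>R w" "(\<xi>, 1)"] mm o(5) L_lightlike[OF \<xi>(1)] by simp
  moreover have "m * L w (\<xi>, 1) \<ge> 0" using \<xi> o by simp
  ultimately show False using \<xi> by simp
qed

lemma sphere_of_subset: "sphere_of v \<subseteq> cap v" "open_cap v \<subseteq> cap v" "cap v = open_cap v \<union> sphere_of v"
  by (auto simp: sphere_of_def cap_def open_cap_def)

lemma open_shell_commute: "open_shell v w = open_shell w v"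
  by (auto simp: open_shell_def)

lemma closed_cap: "closed (cap v)"
proof -
  have "cap v = S3 \<inter> {\<xi>. 0 \<le> L v (\<xi>, 1)}" by (auto simp: cap_def)
  moreover have "closed {\<xi>. 0 \<le> L v (\<xi>, 1)}"
    unfolding lorentz_form_def by (intro closed_Collect_le continuous_intros)
  ultimately show ?thesis by (simp add: S3_def closed_Int)
qed

lemma S3_minus_open_shell: "S3 - open_shell v w = cap v \<union> cap w"
  by (auto simp: open_shell_def cap_def)

lemma frontier_shell:
  assumes "opposite m v w"
  shows "top_of_set S3 frontier_of shell v w = sphere_of v \<union> sphere_of w"
proof -
  have "closedin (top_of_set S3) (shell v w)"
    using opposite_shell_topology(5)[OF assms] by (auto simp: closedin_closed_eq compact_imp_closed shell_def S3_def intro!: closed_subset)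
  then have "top_of_set S3 frontier_of shell v w = shell v w - open_shell v w"
    by (simp add: frontier_of_def closure_of_closedin opposite_shell_topology(6)[OF assms])
  also have "\<dots> = sphere_of v \<union> sphere_of w"
    using opposite_caps_disjoint[OF assms]
    by (fastforce simp: shell_def open_shell_def sphere_of_def cap_def disjoint_iff)
  finally show ?thesis .
qed

lemma zone_shell:
  assumes "opposite m v w" shows "zone (shell v w) (sphere_of v) (sphere_of w)"
proof -
  have "L v v = 1" "L w w = 1" using assms by (auto simp: opposite_def)
  moreover have "sphere_of v \<inter> sphere_of w = {}"
    using opposite_caps_disjoint[OF assms] sphere_of_subset by blast
  ultimately show ?thesis
    using frontier_shell[OF assms] opposite_shell_topology(7)[OF assms]
    by (auto simp: zone_def round_sphere_sphere_of shell_def)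
qed

lemma connected_in_caps:
  assumes "opposite m v w" "connected A" "A \<subseteq> cap v \<union> cap w"
  shows "A \<subseteq> cap v \<or> A \<subseteq> cap w"
proof (rule ccontr)
  assume "\<not> ?thesis"
  then have "cap v \<inter> A \<noteq> {}" "cap w \<inter> A \<noteq> {}" using assms(3) by auto
  moreover have "cap v \<inter> cap w \<inter> A = {}" using opposite_caps_disjoint[OF assms(1)] by auto
  ultimately show False
    using assms(2,3) closed_cap unfolding connected_closed by blast
qed

lemma components_caps:
  assumes "opposite m v w"
  shows "components (cap v \<union> cap w) = {cap v, cap w}"
proof -
  have ne: "cap v \<noteq> {}" "cap w \<noteq> {}" "connected (cap v)" "connected (cap w)"
    using opposite_shell_topology(1,3)[OF assms] opposite_shell_topology(1,3)[OF opposite_commute[OF assms]]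
      sphere_of_subset(1) by blast+
  have disj: "cap v \<inter> cap w = {}" by (rule opposite_caps_disjoint[OF assms])
  show ?thesis
  proof (intro equalityI subsetI)
    fix A assume A: "A \<in> components (cap v \<union> cap w)"
    then have a: "connected A" "A \<subseteq> cap v \<union> cap w" "A \<noteq> {}"
      using in_components_connected in_components_subset in_components_nonempty by blast+
    from connected_in_caps[OF assms a(1,2)] show "A \<in> {cap v, cap w}"
    proof
      assume s: "A \<subseteq> cap v"
      then have "cap v \<subseteq> A" using components_maximal[OF A ne(3)] a(3) by blast
      then show ?thesis using s by blast
    next
      assume s: "A \<subseteq> cap w"
      then have "cap w \<subseteq> A" using components_maximal[OF A ne(4)] a(3) by blast
      then show ?thesis using s by blast
    qed
  next
    fix A assume "A \<in> {cap v, cap w}"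
    then consider "A = cap v" | "A = cap w" by blast
    then show "A \<in> components (cap v \<union> cap w)"
    proof cases
      case 1
      have "d = cap v" if "cap v \<subseteq> d" "d \<subseteq> cap v \<union> cap w" "connected d" for d
        using connected_in_caps[OF assms that(3,2)] that disj ne by blast
      then show ?thesis unfolding in_components_maximal 1 using ne by blast
    next
      case 2
      have "d = cap w" if "cap w \<subseteq> d" "d \<subseteq> cap v \<union> cap w" "connected d" for d
        using connected_in_caps[OF assms that(3,2)] that disj ne by blast
      then show ?thesis unfolding in_components_maximal 2 using ne by blast
    qed
  qed
qed

text \<open>The three open regions into which the two spheres cut the 3-sphere are connected and avoid the
frontier of \<open>Z\<close>, so \<open>Z\<close> contains or misses each of them. It contains the middle region, because
otherwise the two closed caps would disconnect it. It misses the open caps: if it contained one, the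
boundary of this cap would be interior to \<open>Z\<close>.\<close>

lemma zone_interior:
  assumes o: "opposite m v w" and z: "zone Z (sphere_of v) (sphere_of w)"
  shows "top_of_set S3 interior_of Z = open_shell v w"
proof -
  let ?T = "top_of_set S3"
  define I where "I = ?T interior_of Z"
  have Z: "Z \<subseteq> S3" and fr: "?T frontier_of Z = sphere_of v \<union> sphere_of w"
    using z by (auto simp: zone_def)
  have o': "opposite m w v" by (rule opposite_commute[OF o])
  obtain f g where h: "homeomorphism Z (sphere (0::real^3) 1 \<times> {0..1::real}) f g"
    using z by (auto simp: zone_def diffeomorphic_def)
  have cs: "connected (sphere (0::real^3) 1 \<times> {0..1::real})"
    by (intro connected_Times connected_sphere) auto
  have ks: "compact (sphere (0::real^3) 1 \<times> {0..1::real})"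
    by (intro compact_Times) auto
  have cZ: "connected Z" and "compact Z"
    using connected_continuous_image[OF _ cs, of g] compact_continuous_image[OF _ ks, of g] h
    by (auto simp: homeomorphism_def)
  then have "closedin ?T Z" using Z by (simp add: closed_subset compact_imp_closed)
  then have ZI: "Z - I = sphere_of v \<union> sphere_of w"
    using fr by (simp add: frontier_of_def closure_of_closedin I_def)
  have IZ: "I \<subseteq> Z" by (simp add: I_def interior_of_subset)
  have oI: "A \<subseteq> I" if "openin ?T A" "A \<subseteq> Z" for A
    using that by (simp add: I_def interior_of_maximal)
  have disj: "cap v \<inter> cap w = {}" by (rule opposite_caps_disjoint[OF o])
  have dich: "C \<subseteq> Z \<or> C \<inter> Z = {}" if "connected C" "C \<subseteq> S3" "C \<inter> (sphere_of v \<union> sphere_of w) = {}" for C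
  proof (rule ccontr)
    assume "\<not> ?thesis"
    then have "C \<inter> Z \<noteq> {}" "C - Z \<noteq> {}" by auto
    moreover have "connectedin ?T C" using that by (simp add: connectedin_subtopology)
    ultimately have "C \<inter> ?T frontier_of Z \<noteq> {}" using connectedin_Int_frontier_of by metis
    then show False using that fr by simp
  qed
  have S3: "S3 = cap v \<union> cap w \<union> open_shell v w"
    using S3_minus_open_shell[of v w] by (auto simp: open_shell_def)
  have sph: "sphere_of v \<subseteq> Z" "sphere_of w \<subseteq> Z" using ZI by auto
  have "open_shell v w \<inter> Z \<noteq> {}"
  proof
    assume "open_shell v w \<inter> Z = {}"
    then have "Z \<subseteq> cap v \<union> cap w" using Z S3 by blast
    then have "Z \<subseteq> cap v \<or> Z \<subseteq> cap w" by (rule connected_in_caps[OF o cZ])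
    then show False
      using sph disj sphere_of_subset opposite_shell_topology(3)[OF o] opposite_shell_topology(3)[OF o'] by blast
  qed
  moreover have Md: "open_shell v w \<subseteq> S3" "open_shell v w \<inter> (sphere_of v \<union> sphere_of w) = {}"
    by (auto simp: open_shell_def sphere_of_def)
  ultimately have M: "open_shell v w \<subseteq> Z"
    using dich[OF opposite_shell_topology(4)[OF o]] by blast
  have side: "open_cap a \<inter> Z = {}"
    if ab: "opposite m a b" "open_shell a b \<subseteq> Z" "sphere_of a \<subseteq> Z" "sphere_of a \<inter> I = {}"
      "open_cap a \<inter> (sphere_of v \<union> sphere_of w) = {}" for a b
  proof (rule ccontr)
    assume "open_cap a \<inter> Z \<noteq> {}"
    then have "open_cap a \<subseteq> Z"
      using dich[OF opposite_shell_topology(2)[OF ab(1)] _ ab(5)] by (auto simp: open_cap_def)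
    then have "S3 - cap b \<subseteq> Z"
      using ab S3_minus_open_shell[of a b] sphere_of_subset(3)[of a] by blast
    moreover have "openin ?T (S3 - cap b)"
      using closed_cap[of b] by (intro openin_diff closed_subset) (auto simp: cap_def)
    ultimately have "S3 - cap b \<subseteq> I" using oI by blast
    moreover have "sphere_of a \<subseteq> S3 - cap b"
      using opposite_caps_disjoint[OF ab(1)] sphere_of_subset(1)[of a] by (auto simp: sphere_of_def)
    ultimately show False using ab(4) opposite_shell_topology(3)[OF ab(1)] by blast
  qed
  have I0: "sphere_of v \<inter> I = {}" "sphere_of w \<inter> I = {}" using ZI by blast+
  have c: "open_cap v \<inter> sphere_of v = {}" "open_cap w \<inter> sphere_of w = {}"
    by (auto simp: open_cap_def sphere_of_def)
  have "open_cap v \<inter> (sphere_of v \<union> sphere_of w) = {}"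
    using c(1) disj sphere_of_subset(1)[of w] sphere_of_subset(2)[of v] by blast
  then have "open_cap v \<inter> Z = {}" by (rule side[OF o M sph(1) I0(1)])
  moreover have "open_cap w \<inter> (sphere_of v \<union> sphere_of w) = {}"
    using c(2) disj sphere_of_subset(1)[of v] sphere_of_subset(2)[of w] by blast
  then have "open_cap w \<inter> Z = {}"
    using M by (intro side[OF o' _ sph(2) I0(2)]) (simp_all add: open_shell_commute)
  ultimately have "Z \<subseteq> sphere_of v \<union> sphere_of w \<union> open_shell v w"
    using Z S3 sphere_of_subset(3)[of v] sphere_of_subset(3)[of w] by blast
  then have "I \<subseteq> open_shell v w"
    using IZ I0 by blast
  moreover have "open_shell v w \<subseteq> I"
    using M Md ZI by blast
  ultimately show ?thesis by (simp add: I_def)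
qed

text \<open>Such a vector is a point of the hyperplane of hyperbolic space that the sphere bounds.\<close>

lemma orthogonal_timelike_exists:
  assumes "L v v = 1" obtains n where "L n n = -1" "snd n > 0" "L n v = 0"
proof -
  obtain a c where v: "v = (a, c)" by (cases v)
  have a2: "a \<bullet> a = 1 + c * c" using assms by (simp add: v lorentz_form_def)
  define N where "N = 1 + c * c"
  have N: "N > 0" by (simp add: N_def add_pos_nonneg)
  define n :: lorentz_space where "n = sqrt N *\<^sub>R ((c / N) *\<^sub>R a, 1)"
  have "L ((c / N) *\<^sub>R a, 1) ((c / N) *\<^sub>R a, 1) = - (1 / N)"
    using N by (simp add: lorentz_form_def a2 N_def[symmetric] field_simps) (simp add: N_def algebra_simps)
  then have "L n n = -1" using N by (simp add: n_def del: scaleR_Pair)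
  moreover have "L n v = 0" using N by (simp add: n_def v lorentz_form_def a2 N_def[symmetric])
  ultimately show thesis using that[of n] N by (simp add: n_def)
qed

lemma inner_attains_on_sphere:
  fixes g :: "'a::euclidean_space"
  assumes "DIM('a) \<ge> 2" "\<bar>b\<bar> \<le> norm g"
  obtains z where "norm z = 1" "g \<bullet> z = b"
proof -
  \<comment> \<open>for \<open>g = 0\<close> the number \<open>b\<close> is 0 as well, and any unit vector will do\<close>
  define y where "y = (if g = 0 then SOME i. i \<in> Basis else g /\<^sub>R norm g)"
  have "(SOME i::'a. i \<in> Basis) \<in> Basis" by (simp add: some_in_eq)
  then have y: "norm y = 1" "g \<bullet> y = norm g"
    by (auto simp: y_def dot_square_norm power2_eq_square)
  have "connected ((\<lambda>z. g \<bullet> z) ` sphere 0 1)"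
    by (intro connected_continuous_image connected_sphere continuous_intros assms(1))
  moreover have "norm g \<in> (\<lambda>z. g \<bullet> z) ` sphere 0 1" "- norm g \<in> (\<lambda>z. g \<bullet> z) ` sphere 0 1"
    using y by (force intro!: image_eqI[of _ _ y], force intro!: image_eqI[of _ _ "- y"])
  ultimately have "b \<in> (\<lambda>z. g \<bullet> z) ` sphere 0 1"
    using connectedD_interval[of _ "- norm g" "norm g" b] assms(2) by (simp add: abs_le_iff)
  then show thesis using that by auto
qed

text \<open>In a chart in which the first sphere is the unit sphere, a point \<open>z\<close> of it lies on the second sphere
if \<open>b + g \<bullet> z = 0\<close>, where \<open>w = - b n + L w v v + E g\<close>. This equation has no unit solution only if
\<open>norm g\<close> is less than \<open>\<bar>b\<bar>\<close>, and then \<open>L w w = 1\<close> forces \<open>L w v\<close> to exceed 1 in absolute value.\<close>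

lemma disjoint_spheres_L_gt_1:
  assumes v: "L v v = 1" and w: "L w w = 1" and disj: "sphere_of v \<inter> sphere_of w = {}"
  shows "\<bar>L v w\<bar> > 1"
proof -
  obtain n where n: "L n n = -1" "snd n > 0" "L n v = 0" using orthogonal_timelike_exists[OF v] .
  obtain E G where ch: "sphere_chart n v E G" using sphere_chart_exists[OF n(1,2) v n(3)] .
  interpret sphere_chart n v E G by (rule ch)
  define b g where "b = L w n" and "g = G w"
  have wX: "L w X = - b * L n X + L w v * L v X + L (E g) X" for X
  proof -
    have "L w X = L (- L w n *\<^sub>R n + L w v *\<^sub>R v + E (G w)) X" using split[of w] by simp
    then show ?thesis by (simp add: b_def g_def)
  qed
  have "norm g < \<bar>b\<bar>"
  proof (rule ccontr)
    assume "\<not> norm g < \<bar>b\<bar>"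
    then obtain z where z: "norm z = 1" "g \<bullet> z = - b"
      using inner_attains_on_sphere[of "- b" g] by (auto simp: not_less)
    have zz: "z \<bullet> z = 1" using z(1) by (simp add: dot_square_norm)
    have "L w (ray z) = 0"
      using z(2) zz by (simp add: ray_def b_def[symmetric] wX[of "E z"] comm E)
    then have "chart z \<in> sphere_of w"
      using L_chart_sign[of w z] chart_in_S3[of z] by (simp add: sphere_of_def sgn_0_0)
    moreover have "chart z \<in> sphere_of v" using z(1) by (simp add: cap_chart)
    ultimately show False using disj by blast
  qed
  then have "(norm g)\<^sup>2 < b\<^sup>2" by (metis norm_ge_zero power2_abs power_strict_mono zero_less_numeral)
  moreover have "L w w = - b * b + L w v * L w v + g \<bullet> g"
    using wX[of w] wX[of "E g"] by (simp add: L_commute[of n w] L_commute[of v w] L_commute[of "E g" w] b_def comm E)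
  ultimately have "(L w v)\<^sup>2 > 1\<^sup>2" using w by (simp add: dot_square_norm power2_eq_square)
  then have "\<bar>L w v\<bar> > 1" using abs_le_square_iff[of "L w v" 1] by (simp add: not_le[symmetric])
  then show ?thesis by (simp add: L_commute)
qed

lemma sphere_of_uminus: "sphere_of (- v) = sphere_of v"
  by (simp add: sphere_of_def)

lemma opposite_exists:
  assumes v: "L v v = 1" and w: "L w w = 1" and disj: "sphere_of v \<inter> sphere_of w = {}"
  obtains v' w' where "opposite \<bar>L v w\<bar> v' w'" "sphere_of v' = sphere_of v" "sphere_of w' = sphere_of w"
proof -
  define m where "m = \<bar>L v w\<bar>"
  have m: "m > 1" using disjoint_spheres_L_gt_1[OF assms] by (simp add: m_def)
  define w0 where "w0 = (if L v w < 0 then w else - w)"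
  have w0: "L w0 w0 = 1" "L v w0 = - m" "L w0 v = - m" "sphere_of w0 = sphere_of w"
    by (auto simp: w0_def m_def w sphere_of_uminus L_commute[of w v])
  have "m * m > 1" using m by (simp add: less_1_mult)
  moreover have "L (v + m *\<^sub>R w0) (v + m *\<^sub>R w0) = 1 - m * m" by (simp add: v w0 algebra_simps)
  ultimately have "snd (v + m *\<^sub>R w0) \<noteq> 0" by (intro timelike_snd_nonzero) simp
  then consider "snd (v + m *\<^sub>R w0) > 0" | "snd (- v + m *\<^sub>R (- w0)) > 0" by fastforce
  then show thesis
  proof cases
    case 1
    then have "opposite m v w0" using v w0 m by (simp add: opposite_def)
    then show ?thesis using that[of v w0] w0 by (simp add: m_def)
  next
    case 2
    then have "opposite m (- v) (- w0)" using v w0 m by (simp add: opposite_def)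
    then show ?thesis using that[of "- v" "- w0"] w0 by (simp add: m_def sphere_of_uminus)
  qed
qed

section \<open>The maximal Lorentzian modulus of four points\<close>

lemma stereo_in_cap_iff: "stereo x \<in> cap v \<longleftrightarrow> L v (light_vector x) \<ge> 0"
proof -
  have "(norm x)\<^sup>2 + 1 > 0" by (simp add: add_nonneg_pos)
  then show ?thesis
    using stereo_in_S3[of x] by (simp add: cap_def light_vector_def zero_le_mult_iff del: scaleR_Pair)
qed

lemma separating_caps_le_ptolemy:
  assumes "distinct [x1, x2, x3, x4]" "opposite m v w"
    "stereo x1 \<in> cap v" "stereo x3 \<in> cap v" "stereo x2 \<in> cap w" "stereo x4 \<in> cap w"
  shows "m \<le> ptolemy_ratio x1 x2 x3 x4"
proof -
  from closest_points_of_geodesics[OF assms(1)] obtain p1 p3 q2 q4 P Q where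
    c: "p1 > 0" "p3 > 0" "q2 > 0" "q4 > 0"
      "P = p1 *\<^sub>R light_vector x1 + p3 *\<^sub>R light_vector x3"
      "Q = q2 *\<^sub>R light_vector x2 + q4 *\<^sub>R light_vector x4"
    and PQ: "L P P = -1" "snd P > 0" "L Q Q = -1" "snd Q > 0"
      "L P Q = - ptolemy_ratio x1 x2 x3 x4"
    by metis
  have "L v P \<ge> 0" "L w Q \<ge> 0"
    using assms(3-6) c by (auto simp: stereo_in_cap_iff)
  then show ?thesis
    using hyperplanes_within_distance[of v w m P Q] assms(2) PQ by (auto simp: opposite_def)
qed

text \<open>The strict lower bound shows that four points with Ptolemy ratio 1 admit no separating zone.\<close>

lemma lorentzian_modulus_of_separating_zone:
  assumes "distinct [x1, x2, x3, x4]" "separating_zone x1 x2 x3 x4 Z" "has_lorentzian_modulus Z m"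
  shows "1 < m" "m \<le> ptolemy_ratio x1 x2 x3 x4"
proof -
  obtain v1 v2 where z: "zone Z (sphere_of v1) (sphere_of v2)" and v: "L v1 v1 = 1" "L v2 v2 = 1"
    and m: "m = \<bar>L v1 v2\<bar>"
    using assms(3) unfolding has_lorentzian_modulus_def sphere_vector_iff by blast
  have "sphere_of v1 \<inter> sphere_of v2 = {}" using z by (simp add: zone_def)
  from opposite_exists[OF v this] obtain v w where o: "opposite m v w"
    and s: "sphere_of v = sphere_of v1" "sphere_of w = sphere_of v2" unfolding m by blast
  show "1 < m" using o by (simp add: opposite_def)
  have "top_of_set S3 interior_of Z = open_shell v w"
    using zone_interior[OF o] z s by simp
  then have "S3 - top_of_set S3 interior_of Z = cap v \<union> cap w"
    by (simp add: S3_minus_open_shell)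
  then obtain A B where AB: "A \<in> {cap v, cap w}" "B \<in> {cap v, cap w}" "A \<noteq> B"
    "{stereo x1, stereo x3} \<subseteq> A" "{stereo x2, stereo x4} \<subseteq> B"
    using assms(2) components_caps[OF o] unfolding separating_zone_def by metis
  then consider "A = cap v" "B = cap w" | "A = cap w" "B = cap v" by blast
  then show "m \<le> ptolemy_ratio x1 x2 x3 x4"
  proof cases
    case 1
    then show ?thesis using separating_caps_le_ptolemy[OF assms(1) o] AB by simp
  next
    case 2
    then show ?thesis using separating_caps_le_ptolemy[OF assms(1) opposite_commute[OF o]] AB by simp
  qed
qed

text \<open>The two spheres bound the hyperplanes through \<open>P\<close> and \<open>Q\<close> that are perpendicular to the geodesic
\<open>P Q\<close>. They contain the geodesics \<open>x1 x3\<close> and \<open>x2 x4\<close>, so that all four points lie on the spheres.\<close>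

lemma ptolemy_ratio_attained:
  assumes "distinct [x1, x2, x3, x4]" and gt: "ptolemy_ratio x1 x2 x3 x4 > 1"
  obtains Z where "separating_zone x1 x2 x3 x4 Z"
    "has_lorentzian_modulus Z (ptolemy_ratio x1 x2 x3 x4)"
proof -
  define \<mu> where "\<mu> = ptolemy_ratio x1 x2 x3 x4"
  from closest_points_of_geodesics[OF assms(1)] obtain P Q where
    PQ: "L P P = -1" "L Q Q = -1" "snd Q > 0" "L P Q = - \<mu>"
    and X: "L Q (light_vector x1) = \<mu> * L P (light_vector x1)"
      "L Q (light_vector x3) = \<mu> * L P (light_vector x3)"
      "L P (light_vector x2) = \<mu> * L Q (light_vector x2)"
      "L P (light_vector x4) = \<mu> * L Q (light_vector x4)"
    unfolding \<mu>_def by metis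
  have QP: "L Q P = - \<mu>" using PQ(4) by (simp add: L_commute)
  define s where "s = sqrt (\<mu>\<^sup>2 - 1)"
  have "\<mu>\<^sup>2 > 1" using gt by (simp add: \<mu>_def one_less_power)
  then have s: "s > 0" "\<mu> * \<mu> = s * s + 1" by (auto simp: s_def power2_eq_square)
  define v w where "v = (1 / s) *\<^sub>R (\<mu> *\<^sub>R P - Q)" and "w = (1 / s) *\<^sub>R (\<mu> *\<^sub>R Q - P)"
  have "v + \<mu> *\<^sub>R w = (1 / s) *\<^sub>R ((\<mu> * \<mu> - 1) *\<^sub>R Q)"
    by (simp add: v_def w_def algebra_simps)
  then have "snd (v + \<mu> *\<^sub>R w) > 0" using s PQ(3) by simp
  moreover have "L (\<mu> *\<^sub>R P - Q) (\<mu> *\<^sub>R P - Q) = s * s" "L (\<mu> *\<^sub>R Q - P) (\<mu> *\<^sub>R Q - P) = s * s"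
    "L (\<mu> *\<^sub>R P - Q) (\<mu> *\<^sub>R Q - P) = - (\<mu> * (s * s))"
    using s(2) by (simp_all add: PQ QP algebra_simps)
  then have "L v v = 1" "L w w = 1" "L v w = - \<mu>"
    using s(1) unfolding v_def w_def L_simps(7,8) by simp_all
  ultimately have o: "opposite \<mu> v w" using gt by (simp add: opposite_def \<mu>_def)
  have "stereo x1 \<in> cap v" "stereo x3 \<in> cap v" "stereo x2 \<in> cap w" "stereo x4 \<in> cap w"
    unfolding stereo_in_cap_iff by (simp_all add: v_def w_def X)
  moreover have "cap v \<noteq> cap w"
    using opposite_caps_disjoint[OF o] \<open>stereo x1 \<in> cap v\<close> by blast
  ultimately have "separating_zone x1 x2 x3 x4 (shell v w)"
    unfolding separating_zone_def opposite_shell_topology(6)[OF o] S3_minus_open_shell components_caps[OF o]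
    using zone_shell[OF o] by blast
  moreover have "has_lorentzian_modulus (shell v w) \<mu>"
    unfolding has_lorentzian_modulus_def sphere_vector_iff
    using zone_shell[OF o] o by (intro exI[of _ "sphere_of v"] exI[of _ "sphere_of w"] exI[of _ v] exI[of _ w])
      (auto simp: opposite_def)
  ultimately show thesis using that by (simp add: \<mu>_def)
qed

lemma separating_zone_has_lorentzian_modulus:
  assumes "separating_zone x1 x2 x3 x4 Z" obtains m where "has_lorentzian_modulus Z m"
proof -
  obtain S1 S2 where z: "zone Z S1 S2" using assms by (auto simp: separating_zone_def)
  obtain v1 v2 where "sphere_vector v1 S1" "sphere_vector v2 S2"
    using z sphere_vector_exists unfolding zone_def by metis
  then show thesis using that z unfolding has_lorentzian_modulus_def by blast
qed

lemma max_lorentzian_modulus_eq_ptolemy_ratio: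
  assumes "distinct [x1, x2, x3, x4]"
  shows "max_lorentzian_modulus x1 x2 x3 x4 = ptolemy_ratio x1 x2 x3 x4"
proof (cases "\<exists>Z. separating_zone x1 x2 x3 x4 Z")
  case True
  then obtain Z m where "separating_zone x1 x2 x3 x4 Z" "has_lorentzian_modulus Z m"
    using separating_zone_has_lorentzian_modulus by metis
  then have "ptolemy_ratio x1 x2 x3 x4 > 1"
    using lorentzian_modulus_of_separating_zone[OF assms] by fastforce
  then obtain Z where "separating_zone x1 x2 x3 x4 Z"
    "has_lorentzian_modulus Z (ptolemy_ratio x1 x2 x3 x4)"
    using ptolemy_ratio_attained[OF assms] by metis
  then have "Sup {m. \<exists>Z. separating_zone x1 x2 x3 x4 Z \<and> has_lorentzian_modulus Z m}
      = ptolemy_ratio x1 x2 x3 x4"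
    using lorentzian_modulus_of_separating_zone(2)[OF assms] by (intro cSup_eq_maximum) auto
  then show ?thesis using True by (simp add: max_lorentzian_modulus_def)
next
  case False
  then have "\<not> ptolemy_ratio x1 x2 x3 x4 > 1"
    using ptolemy_ratio_attained[OF assms] by metis
  then show ?thesis
    using False ptolemy_ratio_ge_1[OF assms] by (simp add: max_lorentzian_modulus_def)
qed

theorem corollary8p1p8:
  fixes f :: "real \<Rightarrow> real^3" and l s t :: real
  assumes "arclength_knot f l"
    and "f s \<noteq> f t"
  shows "cmod (inf_cross_ratio f s t) - Re (inf_cross_ratio f s t) =
           (1 - cos (conformal_angle f s t)) / (dist (f s) (f t))\<^sup>2 \<and>
         ((\<lambda>(h, k). (max_lorentzian_modulus (f s) (f (s + h)) (f t) (f (t + k)) - 1) / (h * k))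
           \<longlongrightarrow> (1 - cos (conformal_angle f s t)) / (dist (f s) (f t))\<^sup>2)
           (at_right 0 \<times>\<^sub>F at_right 0)"
proof
  show "cmod (inf_cross_ratio f s t) - Re (inf_cross_ratio f s t) =
           (1 - cos (conformal_angle f s t)) / (dist (f s) (f t))\<^sup>2"
    by (simp add: inf_cross_ratio_def diff_divide_distrib)
next
  obtain f' where "\<forall>t. (f has_vector_derivative f' t) (at t)" "\<forall>t. norm (f' t) = 1"
    using assms(1) unfolding arclength_knot_def by blast
  then have f': "(f has_vector_derivative f' t) (at t)" "norm (f' t) = 1" for t by auto
  have d: "vector_derivative f (at x) = f' x" for x
    by (rule vector_derivative_at[OF f'(1)])
  define w where "w = f t - f s"
  have "cos (conformal_angle f s t) = 2 * (f' s \<bullet> w) * (f' t \<bullet> w) / (norm w)\<^sup>2 - f' s \<bullet> f' t"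
    using cos_conformal_angle[of f s t] f' assms(2) by (simp add: d w_def)
  moreover have "dist (f s) (f t) = norm w" by (simp add: w_def dist_norm norm_minus_commute)
  moreover note lim = tendsto_ptolemy_ratio[OF f' f' assms(2), folded w_def]
  moreover have "\<forall>\<^sub>F x in at_right 0 \<times>\<^sub>F at_right 0.
      (case x of (h, k) \<Rightarrow> (ptolemy_ratio (f s) (f (s + h)) (f t) (f (t + k)) - 1) / (h * k)) =
      (case x of (h, k) \<Rightarrow> (max_lorentzian_modulus (f s) (f (s + h)) (f t) (f (t + k)) - 1) / (h * k))"
    using lim(2) by eventually_elim (auto simp: max_lorentzian_modulus_eq_ptolemy_ratio)
  note Lim_transform_eventually[OF lim(1) this]
  ultimately show "((\<lambda>(h, k). (max_lorentzian_modulus (f s) (f (s + h)) (f t) (f (t + k)) - 1) / (h * k))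
           \<longlongrightarrow> (1 - cos (conformal_angle f s t)) / (dist (f s) (f t))\<^sup>2)
           (at_right 0 \<times>\<^sub>F at_right 0)"
    by simp
qed

end
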